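(* Let $P\subseteq\mathbb{R}^p\times\mathbb{R}^q$ be a rational polyhedron that is the convex hull of its vertices plus the cone of its extreme rays, let $P_I=\{(x,y)\in P:x\in\mathbb{Z}^p\}$, and let $(\delta^x)^Tx+(\delta^y)^Ty\ge\delta_0$ with $\delta^x\in\mathbb{Q}^p$, $\delta^y\in\mathbb{Q}^q$, $\delta_0\in\mathbb{Q}$ be an inequality that is valid for $P_I$, such that $\min\{(\delta^x)^Tx+(\delta^y)^Ty:(x,y)\in P_I\}$ is attained and equals $\delta_0$, and such that $\min\{(\delta^x)^Tx+(\delta^y)^Ty:(x,y)\in P\}$ is attained and is less than $\delta_0$. Assume $P^x(\delta,\delta_0)=\operatorname{conv}(P^x_I(\delta,\delta_0))$. Let $\text{width-size}(\delta,\delta_0)$ denote the smallest number $w$ for which there exists a finite split polyhedron proof of validity of $(\delta^x)^Tx+(\delta^y)^Ty\ge\delta_0$ for $P_I$ of width size $w$. Then $$\text{width-size}(\delta,\delta_0)=\max\{\text{width-size}(F):F\in\mathcal{F}^V\}.$$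
   Context: Here $n=p+q$ and $p>0$. Split polyhedra: a convex set $C\subseteq\mathbb{R}^p$ is lattice point free if $\operatorname{ri}(C)\cap\mathbb{Z}^p=\emptyset$. A split polyhedron in $\mathbb{R}^p$ is a lattice point free rational polyhedron that is maximal with respect to inclusion (among lattice point free convex sets). Every split polyhedron is full dimensional and is the sum of a rational polytope and a linear space. A mixed integer split polyhedron is a set $L=\{(x,y)\in\mathbb{R}^p\times\mathbb{R}^q:x\in L^x\}$ with $L^x$ a split polyhedron in $\mathbb{R}^p$. Max-facet-width: write $L=\{z\in\mathbb{R}^n:(\pi^k)^Tz\ge\pi^k_0,\ k\in N_f(L)\}$ with one inequality per facet, $(\pi^k,\pi^k_0)\in\mathbb{Z}^{n+1}$, $\pi^k_j=0$ for $j>p$, and $\pi_0^k,\pi_1^k,\dots,\pi_p^k$ having no common divisor greater than 1 (this representation is unique). Then $w_f(L)=\max_{k\in N_f(L)}\big(\max_{z\in L}(\pi^k)^Tz-\min_{z\in L}(\pi^k)^Tz\big)$. Relaxations and proofs: for a polyhedron $Q\subseteq\mathbb{R}^n$, $R(L,Q):=\operatorname{conv}(\{z\in Q:z\notin\operatorname{int}(L)\})$. For a finite family $\mathcal{S}$ of mixed integer split polyhedra, $\mathrm{Cl}(\mathcal{S},Q):=\bigcap_{L\in\mathcal{S}}R(L,Q)$, $P^0(\mathcal{S},P):=P$ and $P^{k+1}(\mathcal{S},P):=\mathrm{Cl}(\mathcal{S},P^k(\mathcal{S},P))$. A finite split polyhedron proof of validity of an inequality for $P_I$ is a finite family $\mathcal{S}$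 of mixed integer split polyhedra such that the inequality is valid for $P^k(\mathcal{S},P)$ for some finite $k$. Its width size is $\max\{w_f(L):L\in\mathcal{S}\}$. Projections and faces: $P(\delta,\delta_0):=\{(x,y)\in P:(\delta^x)^Tx+(\delta^y)^Ty\le\delta_0\}$, $P^x(\delta,\delta_0):=\{x\in\mathbb{R}^p:\exists y\in\mathbb{R}^q,\ (x,y)\in P(\delta,\delta_0)\}$, $P^x_I(\delta,\delta_0):=P^x(\delta,\delta_0)\cap\mathbb{Z}^p$. Let $\mathcal{F}$ be the finite set of all faces of $P^x(\delta,\delta_0)$ (including the improper face $P^x(\delta,\delta_0)$ itself), and let $\mathcal{F}^V$ be the set of violated faces, i.e. those $F\in\mathcal{F}$ for which there exists $(x,y)\in P$ with $x\in F$ and $(\delta^x)^Tx+(\delta^y)^Ty<\delta_0$. Every violated face is lattice point free. For a lattice point free rational polyhedron $F\subseteq\mathbb{R}^p$, $\text{width-size}(F)$ is the minimum of $w_f(L)$ over all mixed integer split polyhedra $L=L^x\times\mathbb{R}^q$ with $\operatorname{ri}(F)\subseteq\operatorname{int}(L^x)$. *)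

theory Defs
  imports "HOL-Analysis.Analysis"
begin

(* Conventions.  The space R^p x R^q = R^n is real ^ 'n, and R^p is real ^ 'p.  An injection
   \<iota> :: 'p \<Rightarrow> 'n names the coordinates of z = (x,y) that make up x; the q = n - p coordinates
   outside the range of \<iota> make up y.  Index types are nonempty, so p > 0 is automatic, while the
   pure integer case q = 0 is included (\<iota> bijective); it would be lost with the product type
   (real ^ 'p) \<times> (real ^ 'q). *)

definition int_vec :: "real ^ 'n \<Rightarrow> bool" where
  "int_vec z \<longleftrightarrow> (\<forall>i. z $ i \<in> \<int>)"

definition rat_vec :: "real ^ 'n \<Rightarrow> bool" where
  "rat_vec z \<longleftrightarrow> (\<forall>i. z $ i \<in> \<rat>)"

definition real_vec :: "int ^ 'n \<Rightarrow> real ^ 'n" where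
  "real_vec \<pi> = (\<chi> i. real_of_int (\<pi> $ i))"

definition xpart :: "('p::finite \<Rightarrow> 'n::finite) \<Rightarrow> real ^ 'n \<Rightarrow> real ^ 'p" where
  "xpart \<iota> z = (\<chi> i. z $ \<iota> i)"

definition rational_polyhedron :: "(real ^ 'n) set \<Rightarrow> bool" where
  "rational_polyhedron S \<longleftrightarrow>
     (\<exists>C. finite C \<and> (\<forall>(a, b)\<in>C. rat_vec a \<and> b \<in> \<rat>) \<and> S = {z. \<forall>(a, b)\<in>C. a \<bullet> z \<le> b})"

definition recession_cone :: "'a::real_vector set \<Rightarrow> 'a set" where
  "recession_cone S = {r. \<forall>z\<in>S. \<forall>t\<ge>0. z + t *\<^sub>R r \<in> S}"

definition extreme_ray_of :: "'a::real_vector \<Rightarrow> 'a set \<Rightarrow> bool" where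
  "extreme_ray_of r S \<longleftrightarrow> r \<noteq> 0 \<and> (conic hull {r}) face_of (recession_cone S)"

definition generated_by_vertices_and_rays :: "'a::real_vector set \<Rightarrow> bool" where
  "generated_by_vertices_and_rays S \<longleftrightarrow>
     S = {v + r | v r. v \<in> convex hull {v. v extreme_point_of S} \<and>
                       r \<in> convex_cone hull {r. extreme_ray_of r S}}"


definition lattice_point_free :: "(real ^ 'p) set \<Rightarrow> bool" where
  "lattice_point_free C \<longleftrightarrow> convex C \<and> rel_interior C \<inter> {x. int_vec x} = {}"

definition split_polyhedron :: "(real ^ 'p) set \<Rightarrow> bool" where
  "split_polyhedron L \<longleftrightarrow> rational_polyhedron L \<and> lattice_point_free L \<and>
     (\<forall>C. lattice_point_free C \<and> L \<subseteq> C \<longrightarrow> C = L)"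

definition cylinder :: "('p::finite \<Rightarrow> 'n::finite) \<Rightarrow> (real ^ 'p) set \<Rightarrow> (real ^ 'n) set" where
  "cylinder \<iota> Lx = {z. xpart \<iota> z \<in> Lx}"

definition mi_split_polyhedron :: "('p::finite \<Rightarrow> 'n::finite) \<Rightarrow> (real ^ 'n) set \<Rightarrow> bool" where
  "mi_split_polyhedron \<iota> L \<longleftrightarrow> (\<exists>Lx. split_polyhedron Lx \<and> L = cylinder \<iota> Lx)"

(* The pairs (\<pi>, \<pi>0) of the unique primitive integral representation of L: for full-dimensional L
   each facet is cut out by exactly one such pair. *)
definition facet_ineqs :: "('p::finite \<Rightarrow> 'n::finite) \<Rightarrow> (real ^ 'n) set \<Rightarrow> ((int ^ 'n) \<times> int) set" where
  "facet_ineqs \<iota> L =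
     {(\<pi>, \<pi>0). L \<subseteq> {z. real_vec \<pi> \<bullet> z \<ge> real_of_int \<pi>0} \<and>
               (L \<inter> {z. real_vec \<pi> \<bullet> z = real_of_int \<pi>0}) facet_of L \<and>
               (\<forall>j. j \<notin> range \<iota> \<longrightarrow> \<pi> $ j = 0) \<and>
               Gcd (insert \<pi>0 (range (\<lambda>i. \<pi> $ \<iota> i))) = 1}"

(* On a mixed integer split polyhedron the supremum and infimum below are attained, as L is the sum
   of a polytope and a linear space on which every facet normal vanishes. *)
definition max_facet_width :: "('p::finite \<Rightarrow> 'n::finite) \<Rightarrow> (real ^ 'n) set \<Rightarrow> real" where
  "max_facet_width \<iota> L =
     Max ((\<lambda>(\<pi>, \<pi>0). (SUP z\<in>L. real_vec \<pi> \<bullet> z) - (INF z\<in>L. real_vec \<pi> \<bullet> z)) ` facet_ineqs \<iota> L)"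


definition relax :: "(real ^ 'n) set \<Rightarrow> (real ^ 'n) set \<Rightarrow> (real ^ 'n) set" where
  "relax L Q = convex hull {z \<in> Q. z \<notin> interior L}"

definition Cl :: "(real ^ 'n) set set \<Rightarrow> (real ^ 'n) set \<Rightarrow> (real ^ 'n) set" where
  "Cl \<S> Q = (\<Inter>L\<in>\<S>. relax L Q)"

definition iterated_Cl :: "nat \<Rightarrow> (real ^ 'n) set set \<Rightarrow> (real ^ 'n) set \<Rightarrow> (real ^ 'n) set" where
  "iterated_Cl k \<S> P = (Cl \<S> ^^ k) P"

definition valid_ineq :: "real ^ 'n \<Rightarrow> real \<Rightarrow> (real ^ 'n) set \<Rightarrow> bool" where
  "valid_ineq \<delta> \<delta>0 Q \<longleftrightarrow> (\<forall>z\<in>Q. \<delta> \<bullet> z \<ge> \<delta>0)"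

definition split_proof ::
    "('p::finite \<Rightarrow> 'n::finite) \<Rightarrow> (real ^ 'n) set \<Rightarrow> real ^ 'n \<Rightarrow> real \<Rightarrow> (real ^ 'n) set set \<Rightarrow> bool" where
  "split_proof \<iota> P \<delta> \<delta>0 \<S> \<longleftrightarrow>
     finite \<S> \<and> (\<forall>L\<in>\<S>. mi_split_polyhedron \<iota> L) \<and> (\<exists>k. valid_ineq \<delta> \<delta>0 (iterated_Cl k \<S> P))"

definition proof_width :: "('p::finite \<Rightarrow> 'n::finite) \<Rightarrow> (real ^ 'n) set set \<Rightarrow> real" where
  "proof_width \<iota> \<S> = Max (max_facet_width \<iota> ` \<S>)"

definition mixed_int_points :: "('p::finite \<Rightarrow> 'n::finite) \<Rightarrow> (real ^ 'n) set \<Rightarrow> (real ^ 'n) set" where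
  "mixed_int_points \<iota> P = {z \<in> P. int_vec (xpart \<iota> z)}"

definition proj_level :: "('p::finite \<Rightarrow> 'n::finite) \<Rightarrow> (real ^ 'n) set \<Rightarrow> real ^ 'n \<Rightarrow> real \<Rightarrow> (real ^ 'p) set" where
  "proj_level \<iota> P \<delta> \<delta>0 = xpart \<iota> ` {z \<in> P. \<delta> \<bullet> z \<le> \<delta>0}"

definition violated_faces ::
    "('p::finite \<Rightarrow> 'n::finite) \<Rightarrow> (real ^ 'n) set \<Rightarrow> real ^ 'n \<Rightarrow> real \<Rightarrow> (real ^ 'p) set set" where
  "violated_faces \<iota> P \<delta> \<delta>0 =
     {F. F face_of proj_level \<iota> P \<delta> \<delta>0 \<and> (\<exists>z\<in>P. xpart \<iota> z \<in> F \<and> \<delta> \<bullet> z < \<delta>0)}"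


(* Facet widths of split polyhedra may be fractional, and LEAST on the reals is unspecified when no
   least element exists; has_minimum expresses that the minima below are well defined. *)
definition has_minimum :: "real set \<Rightarrow> bool" where
  "has_minimum A \<longleftrightarrow> (\<exists>m\<in>A. \<forall>a\<in>A. m \<le> a)"

definition face_widths :: "('p::finite \<Rightarrow> 'n::finite) \<Rightarrow> (real ^ 'p) set \<Rightarrow> real set" where
  "face_widths \<iota> F =
     {max_facet_width \<iota> (cylinder \<iota> Lx) | Lx. split_polyhedron Lx \<and> rel_interior F \<subseteq> interior Lx}"

definition face_width_size :: "('p::finite \<Rightarrow> 'n::finite) \<Rightarrow> (real ^ 'p) set \<Rightarrow> real" where
  "face_width_size \<iota> F = (LEAST w. w \<in> face_widths \<iota> F)"

definition proof_widths ::
    "('p::finite \<Rightarrow> 'n::finite) \<Rightarrow> (real ^ 'n) set \<Rightarrow> real ^ 'n \<Rightarrow> real \<Rightarrow> real set" where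
  "proof_widths \<iota> P \<delta> \<delta>0 = {proof_width \<iota> \<S> | \<S>. split_proof \<iota> P \<delta> \<delta>0 \<S>}"

definition width_size ::
    "('p::finite \<Rightarrow> 'n::finite) \<Rightarrow> (real ^ 'n) set \<Rightarrow> real ^ 'n \<Rightarrow> real \<Rightarrow> real" where
  "width_size \<iota> P \<delta> \<delta>0 = (LEAST w. w \<in> proof_widths \<iota> P \<delta> \<delta>0)"

end

theory Submission
  imports Defs
begin

text \<open>Let \<open>Q\<close> be the projected level set and \<open>F\<close> a violated face of \<open>Q\<close>.

  Lower bound: if no body of a proof contains the relative interior of \<open>F\<close>, then every round keeps the
  hull of the mixed-integer points of value \<open>\<delta>0\<close> over \<open>F\<close>, and also a small piece of the fibre below
  each of its relatively interior points, so the inequality stays violated.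

  Upper bound: choose one optimal split body for each violated face. A point below the level \<open>\<delta>0\<close> that
  survives a round is a convex combination of points at or below the level that project into the same
  face, so induction on the dimension of the face shows that \<open>dim Q + 1\<close> rounds suffice.

  The minima exist although widths of split polyhedra are not a discrete set. A lattice retraction onto
  the affine hull of the lattice points of a split polyhedron \<open>L\<close> replaces \<open>L\<close> by one that is no wider
  and whose facet slacks at lattice points determine the width. These slacks are integers between 0
  and the width, and there are at most \<open>2\<^sup>p\<close> facets, so only finitely many widths remain below a given
  bound.\<close>

section \<open>Integral systems of inequalities and maximal lattice point free sets\<close>

text \<open>Integral affine forms (slacks) carry the argument because their values at lattice points
  are integers. A split polyhedron with interior points is handled as a system in which every
  inequality has a lattice point tight for it alone. This one certificate yields maximality, the
  list of facets and the infimum in each facet width. The decomposition into a polytope and a linear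
  space is bypassed: finiteness of the facet widths comes from Diophantine approximation.

  The assumption that the projected level set is the hull of its lattice points enters twice. In the
  lower bound it lets a face be lifted to the hull of points of value exactly
  \<open>\<delta>0\<close> with integral projection, which no split body can cut off. For the minima
  it forces every body around a face \<open>F\<close> to contain all lattice points of
  \<open>F\<close>; thus \<open>F\<close> lies in the affine hull of the lattice points of the body
  and is fixed by the retraction. The retraction is there because an affine form is determined by
  its values at lattice points only along their affine hull.\<close>

definition slack :: "(int ^ 'n) \<times> int \<Rightarrow> real ^ 'n \<Rightarrow> real" where
  "slack c x = real_vec (fst c) \<bullet> x - real_of_int (snd c)"

definition sol_set :: "((int ^ 'n) \<times> int) set \<Rightarrow> (real ^ 'n) set" where
  "sol_set C = {x. \<forall>c\<in>C. 0 \<le> slack c x}"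

definition strict_set :: "((int ^ 'n) \<times> int) set \<Rightarrow> (real ^ 'n) set" where
  "strict_set C = {x. \<forall>c\<in>C. 0 < slack c x}"

text \<open>The point \<open>v\<close> is tight for \<open>c\<close> and strict for all other
  constraints, so it lies in the relative interior of the facet cut out by \<open>c\<close>, and
  distinct constraints give distinct facets. This is Lovasz's criterion for maximal lattice point
  free polyhedra.\<close>

definition witnessed :: "((int ^ 'n) \<times> int) set \<Rightarrow> bool" where
  "witnessed C \<longleftrightarrow>
     (\<forall>c\<in>C. \<exists>v. int_vec v \<and> slack c v = 0 \<and> v \<in> strict_set (C - {c}))"

lemma slack_affine:
  assumes "u + v = 1"
  shows "slack c (u *\<^sub>R x + v *\<^sub>R y) = u * slack c x + v * slack c y"
proof -
  have "real_of_int (snd c) = (u + v) * real_of_int (snd c)"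
    using assms by simp
  then show ?thesis
    by (simp add: slack_def inner_add_right algebra_simps)
qed

lemma slack_add: "slack c (x + y) = slack c x + real_vec (fst c) \<bullet> y"
  by (simp add: slack_def inner_add_right)

lemma Ints_inner_real_vec:
  assumes "int_vec v"
  shows "real_vec a \<bullet> v \<in> \<int>"
  using assms unfolding int_vec_def inner_vec_def real_vec_def
  by (auto intro!: Ints_sum Ints_mult)

lemma Ints_slack: "int_vec v \<Longrightarrow> slack c v \<in> \<int>"
  by (simp add: slack_def Ints_inner_real_vec)

lemma strict_set_subset: "strict_set C \<subseteq> sol_set C"
  by (force simp: strict_set_def sol_set_def)

lemma strict_set_antimono: "C \<subseteq> C' \<Longrightarrow> strict_set C' \<subseteq> strict_set C"
  by (auto simp: strict_set_def)

lemma sol_set_eq_halfspaces: "sol_set C = (\<Inter>c\<in>C. {x. real_vec (fst c) \<bullet> x \<ge> real_of_int (snd c)})"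
  by (auto simp: sol_set_def slack_def)

lemma strict_set_eq_halfspaces: "strict_set C = (\<Inter>c\<in>C. {x. real_vec (fst c) \<bullet> x > real_of_int (snd c)})"
  by (auto simp: strict_set_def slack_def)

lemma convex_sol_set: "convex (sol_set C)"
  unfolding sol_set_eq_halfspaces by (intro convex_INT convex_halfspace_ge)

lemma closed_sol_set: "closed (sol_set C)"
  unfolding sol_set_eq_halfspaces by (intro closed_INT ballI closed_halfspace_ge)

lemma open_strict_set: "finite C \<Longrightarrow> open (strict_set C)"
  unfolding strict_set_eq_halfspaces by (intro open_INT ballI open_halfspace_gt) auto

lemma polyhedron_sol_set: "finite C \<Longrightarrow> polyhedron (sol_set C)"
  unfolding sol_set_eq_halfspaces
  by (intro polyhedron_Inter) (auto simp: polyhedron_halfspace_ge)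

lemma open_extend:
  fixes x y :: "'a::real_normed_vector"
  assumes "open U" "x \<in> U"
  obtains e where "e > 0" "x + e *\<^sub>R (x - y) \<in> U"
proof -
  have "((\<lambda>t. x + t *\<^sub>R (x - y)) \<longlongrightarrow> x + 0 *\<^sub>R (x - y)) (at_right 0)"
    by (intro tendsto_intros)
  then have "eventually (\<lambda>t. x + t *\<^sub>R (x - y) \<in> U) (at_right 0)"
    using assms topological_tendstoD by force
  then obtain b where "b > 0" "\<And>t. 0 < t \<Longrightarrow> t < b \<Longrightarrow> x + t *\<^sub>R (x - y) \<in> U"
    unfolding eventually_at_right_field by auto
  then have "x + (b / 2) *\<^sub>R (x - y) \<in> U" "b / 2 > 0"
    by auto
  then show thesis
    using that by blast
qed

lemma slack_extend:
  "slack c (x + e *\<^sub>R (x - y)) = (1 + e) * slack c x - e * slack c y"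
  by (simp add: slack_def inner_add_right inner_diff_right algebra_simps)

text \<open>Pushing an interior point slightly away from a strict point keeps it in the set, whereas
  a vanishing slack would become negative. The strict point also excludes degenerate constraints
  whose slack is identically 0.\<close>

lemma interior_sol_set:
  assumes "finite C" "strict_set C \<noteq> {}"
  shows "interior (sol_set C) = strict_set C"
proof
  show "strict_set C \<subseteq> interior (sol_set C)"
    using assms open_strict_set strict_set_subset interior_maximal by blast
next
  obtain x0 where x0: "x0 \<in> strict_set C"
    using assms by blast
  show "interior (sol_set C) \<subseteq> strict_set C"
  proof
    fix x assume "x \<in> interior (sol_set C)"
    then obtain e where e: "e > 0" "x + e *\<^sub>R (x - x0) \<in> interior (sol_set C)"
      using open_extend[OF open_interior] by blast
    have "0 < slack c x" if "c \<in> C" for c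
    proof -
      have "0 \<le> (1 + e) * slack c x - e * slack c x0"
        using e that interior_subset[of "sol_set C"] slack_extend[of c x e x0]
        by (force simp: sol_set_def)
      moreover have "e * slack c x0 > 0"
        using e x0 that by (auto simp: strict_set_def)
      ultimately have "0 < (1 + e) * slack c x"
        by linarith
      then show ?thesis
        using e by (simp add: zero_less_mult_iff)
    qed
    then show "x \<in> strict_set C"
      by (simp add: strict_set_def)
  qed
qed

lemma rel_interior_extend:
  fixes S :: "'a::euclidean_space set"
  assumes "convex S" "x \<in> rel_interior S" "y \<in> S"
  obtains e where "e > 0" "x + e *\<^sub>R (x - y) \<in> S"
proof -
  obtain e where "e > 1" "(1 - e) *\<^sub>R y + e *\<^sub>R x \<in> S"
    using convex_rel_interior_iff[of S x] assms by blast
  then show thesis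
    by (intro that[of "e - 1"]) (auto simp: algebra_simps)
qed

lemma rel_interior_combination:
  fixes S :: "'a::euclidean_space set"
  assumes "convex S" "x \<in> rel_interior S" "y \<in> S"
  obtains y' \<mu> where "y' \<in> S" "0 < \<mu>" "\<mu> < 1" "x = \<mu> *\<^sub>R y + (1 - \<mu>) *\<^sub>R y'"
proof -
  obtain e where e: "e > 0" "x + e *\<^sub>R (x - y) \<in> S"
    using rel_interior_extend[OF assms] .
  have "(1 + e) *\<^sub>R x = e *\<^sub>R y + (x + e *\<^sub>R (x - y))"
    by (simp add: algebra_simps)
  then have "(1 / (1 + e)) *\<^sub>R ((1 + e) *\<^sub>R x) = (1 / (1 + e)) *\<^sub>R (e *\<^sub>R y + (x + e *\<^sub>R (x - y)))"
    by simp
  moreover have "1 - e / (1 + e) = 1 / (1 + e)"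
    using e by (simp add: field_simps)
  ultimately have "x = (e / (1 + e)) *\<^sub>R y + (1 - e / (1 + e)) *\<^sub>R (x + e *\<^sub>R (x - y))"
    using e by (simp add: scaleR_add_right)
  then show thesis
    using e that[OF e(2), of "e / (1 + e)"] by simp
qed

lemma rational_polyhedron_sol_set:
  assumes "finite C"
  shows "rational_polyhedron (sol_set C)"
proof -
  let ?D = "(\<lambda>c. (- real_vec (fst c), - real_of_int (snd c))) ` C"
  have "\<forall>(a, b)\<in>?D. rat_vec a \<and> b \<in> \<rat>"
    by (auto simp: rat_vec_def real_vec_def)
  moreover have "sol_set C = {z. \<forall>(a, b)\<in>?D. a \<bullet> z \<le> b}"
    by (auto simp: sol_set_def slack_def)
  ultimately show ?thesis
    unfolding rational_polyhedron_def using assms by blast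
qed

lemma lattice_point_free_sol_set:
  assumes "finite C" "strict_set C \<noteq> {}"
  shows "lattice_point_free (sol_set C) \<longleftrightarrow> (\<forall>v\<in>strict_set C. \<not> int_vec v)"
proof -
  have "interior (sol_set C) = strict_set C"
    using assms interior_sol_set by blast
  moreover from this have "rel_interior (sol_set C) = strict_set C"
    using assms rel_interior_nonempty_interior by metis
  ultimately show ?thesis
    by (auto simp: lattice_point_free_def convex_sol_set)
qed

text \<open>A lattice point in the relative interior of every facet certifies maximality: a convex set
  reaching beyond a facet contains that facet's lattice point in its interior.\<close>

lemma witnessed_imp_split_polyhedron:
  assumes C: "finite C" "strict_set C \<noteq> {}" "witnessed C"
    and free: "\<And>v. v \<in> strict_set C \<Longrightarrow> \<not> int_vec v"
  shows "split_polyhedron (sol_set C)"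
  unfolding split_polyhedron_def
proof (intro conjI allI impI)
  show "rational_polyhedron (sol_set C)" "lattice_point_free (sol_set C)"
    using C free by (auto simp: lattice_point_free_sol_set rational_polyhedron_sol_set)
  fix K assume "lattice_point_free K \<and> sol_set C \<subseteq> K"
  then have K: "convex K" "rel_interior K \<inter> {x. int_vec x} = {}" "sol_set C \<subseteq> K"
    by (auto simp: lattice_point_free_def)
  have strict: "strict_set C \<subseteq> interior K"
    using K C interior_mono interior_sol_set by metis
  then have "rel_interior K = interior K"
    using C rel_interior_nonempty_interior by blast
  show "K = sol_set C"
  proof (rule ccontr)
    assume "K \<noteq> sol_set C"
    then obtain y c where y: "y \<in> K" "c \<in> C" "slack c y < 0"
      using K by (force simp: sol_set_def)
    then obtain v where v: "int_vec v" "slack c v = 0" "v \<in> strict_set (C - {c})"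
      using C(3) unfolding witnessed_def by blast
    obtain e where e: "e > 0" "v + e *\<^sub>R (v - y) \<in> strict_set (C - {c})"
      using open_extend[OF open_strict_set v(3)] C by blast
    define w where "w = v + e *\<^sub>R (v - y)"
    have "slack c w > 0"
      using y e v by (simp add: w_def slack_extend mult_pos_neg)
    then have "w \<in> strict_set C"
      using e by (auto simp: strict_set_def w_def)
    then have "w \<in> interior K"
      using strict by blast
    moreover have "v = y - (1 / (1 + e)) *\<^sub>R (y - w)"
    proof -
      have "y - w = (1 + e) *\<^sub>R (y - v)"
        by (simp add: w_def algebra_simps)
      then show ?thesis using e by simp
    qed
    ultimately have "v \<in> interior K"
      using mem_interior_convex_shrink[OF K(1), of w y "1 / (1 + e)"] y(1) e by simp
    with v(1) K(2) \<open>rel_interior K = interior K\<close> show False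
      by auto
  qed
qed

text \<open>The constraints in \<open>U\<close> still have to acquire a lattice point: each one is dropped, or relaxed
  until its hyperplane hits a lattice point that is strict for all other constraints.\<close>

lemma extend_to_witnessed_aux:
  assumes "finite U" "finite W" "U \<inter> W = {}"
    and "\<And>v. v \<in> strict_set (U \<union> W) \<Longrightarrow> \<not> int_vec v"
    and "\<forall>c\<in>W. \<exists>v. int_vec v \<and> slack c v = 0 \<and> v \<in> strict_set (U \<union> W - {c})"
  shows "\<exists>C. finite C \<and> witnessed C \<and> (\<forall>v\<in>strict_set C. \<not> int_vec v) \<and> strict_set (U \<union> W) \<subseteq> strict_set C"
  using assms
proof (induction "card U" arbitrary: U W)
  case 0
  then show ?case
    by (intro exI[of _ W]) (auto simp: witnessed_def)
next
  case (Suc n)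
  have "U \<noteq> {}"
    using Suc.hyps(2) by auto
  then obtain c where c: "c \<in> U"
    by blast
  obtain a b where ab: "c = (a, b)"
    by (cases c)
  let ?R = "(U - {c}) \<union> W"
  \<comment> \<open>The values of the normal of \<open>c\<close> at lattice points strict for all
    other constraints. None exceeds \<open>b\<close>, since it would come from a lattice point of
    \<open>strict_set (U \<union> W)\<close>. If there are none, \<open>c\<close> is dropped;
    otherwise the largest one, \<open>m\<close>, becomes the new right-hand side.\<close>
  define M where "M = {k::int. \<exists>v. int_vec v \<and> v \<in> strict_set ?R \<and> real_vec a \<bullet> v = real_of_int k}"
  have card: "n = card (U - {c})" and fin: "finite (U - {c})"
    using Suc.hyps(2) Suc.prems(1) c by auto
  have UW: "U \<union> W = insert c ?R" and cR: "c \<notin> ?R"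
    using c Suc.prems(3) by auto
  have M_le: "k \<le> b" if "k \<in> M" for k
  proof (rule ccontr)
    assume "\<not> k \<le> b"
    with that obtain v where v: "int_vec v" "v \<in> strict_set ?R" "real_vec a \<bullet> v = real_of_int k"
      unfolding M_def by auto
    with \<open>\<not> k \<le> b\<close> have "v \<in> strict_set (U \<union> W)"
      unfolding UW by (auto simp: strict_set_def ab slack_def)
    with Suc.prems(4) v show False by blast
  qed
  show ?case
  proof (cases "M = {}")
    case True
    have "\<not> int_vec v" if "v \<in> strict_set ?R" for v
    proof
      assume v: "int_vec v"
      then obtain k where "real_vec a \<bullet> v = real_of_int k"
        using Ints_inner_real_vec Ints_cases by metis
      with v that have "k \<in> M"
        unfolding M_def by blast
      with True show False by blast
    qed
    moreover have "\<forall>d\<in>W. \<exists>v. int_vec v \<and> slack d v = 0 \<and> v \<in> strict_set (?R - {d})"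
      using Suc.prems(5) strict_set_antimono[of "?R - {d}" "U \<union> W - {d}" for d] by blast
    moreover have disj: "(U - {c}) \<inter> W = {}"
      using Suc.prems(3) by auto
    ultimately obtain C where "finite C" "witnessed C" "\<forall>v\<in>strict_set C. \<not> int_vec v"
      "strict_set ?R \<subseteq> strict_set C"
      using Suc.hyps(1)[OF card fin Suc.prems(2)] disj by metis
    moreover have "strict_set (U \<union> W) \<subseteq> strict_set ?R"
      by (rule strict_set_antimono) auto
    ultimately show ?thesis by blast
  next
    case False
    obtain m where m: "m \<in> M" "\<And>k. k \<in> M \<Longrightarrow> k \<le> m"
    proof -
      obtain k0 where "k0 \<in> M" using False by blast
      let ?N = "M \<inter> {k0..b}"
      have "finite ?N" "?N \<noteq> {}" using \<open>k0 \<in> M\<close> M_le by auto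
      then have "Max ?N \<in> ?N" "\<And>k. k \<in> ?N \<Longrightarrow> k \<le> Max ?N" by (rule Max_in, simp_all)
      moreover have "k \<le> Max ?N" if "k \<in> M" for k
        using calculation(1) calculation(2)[of k] M_le[OF that] that by (cases "k0 \<le> k") auto
      ultimately show thesis
        using that[of "Max ?N"] by blast
    qed
    then obtain v where v: "int_vec v" "v \<in> strict_set ?R" "real_vec a \<bullet> v = real_of_int m"
      unfolding M_def by blast
    let ?c = "(a, m)"
    have sv: "slack ?c v = 0"
      using v by (simp add: slack_def)
    then have notin: "?c \<notin> ?R"
      using v by (force simp: strict_set_def)
    have slack_le: "slack c x \<le> slack ?c x" for x
      using M_le[OF m(1)] by (simp add: slack_def ab)
    have "\<not> int_vec w" if w: "w \<in> strict_set ((U - {c}) \<union> insert ?c W)" for w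
    proof
      assume wi: "int_vec w"
      then obtain k where k: "real_vec a \<bullet> w = real_of_int k"
        using Ints_inner_real_vec Ints_cases by metis
      moreover have "w \<in> strict_set ?R" "0 < slack ?c w"
        using w by (auto simp: strict_set_def)
      ultimately have "k \<in> M" "k > m"
        using wi unfolding M_def by (auto simp: slack_def)
      with m(2) show False by fastforce
    qed
    moreover have "\<exists>v. int_vec v \<and> slack d v = 0 \<and> v \<in> strict_set ((U - {c}) \<union> insert ?c W - {d})"
      if "d \<in> insert ?c W" for d
    proof (cases "d = ?c")
      case True
      have "(U - {c}) \<union> insert ?c W - {?c} \<subseteq> ?R" by auto
      with True v sv strict_set_antimono show ?thesis by blast
    next
      \<comment> \<open>Relaxing \<open>c\<close> can only enlarge its slack, so the witnesses of
        \<open>W\<close> remain strict for the relaxed constraint.\<close>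
      case False
      with that have "d \<in> W" by blast
      with Suc.prems(5) obtain x where x: "int_vec x" "slack d x = 0" "x \<in> strict_set (U \<union> W - {d})"
        by blast
      have "0 < slack c x"
        using x(3) c cR \<open>d \<in> W\<close> by (auto simp: strict_set_def)
      with slack_le[of x] x(3) have "x \<in> strict_set ((U - {c}) \<union> insert ?c W - {d})"
        by (auto simp: strict_set_def)
      with x show ?thesis by blast
    qed
    moreover have "finite (insert ?c W)" "(U - {c}) \<inter> insert ?c W = {}"
      using Suc.prems notin by auto
    ultimately obtain C where "finite C" "witnessed C" "\<forall>v\<in>strict_set C. \<not> int_vec v"
      "strict_set ((U - {c}) \<union> insert ?c W) \<subseteq> strict_set C"
      using Suc.hyps(1)[OF card fin] by metis
    moreover have "strict_set (U \<union> W) \<subseteq> strict_set ((U - {c}) \<union> insert ?c W)"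
    proof
      fix x assume x: "x \<in> strict_set (U \<union> W)"
      then have "0 < slack c x"
        using c by (auto simp: strict_set_def)
      then have "0 < slack ?c x"
        using slack_le[of x] by linarith
      with x show "x \<in> strict_set ((U - {c}) \<union> insert ?c W)"
        by (auto simp: strict_set_def)
    qed
    ultimately show ?thesis by blast
  qed
qed

lemma extend_to_split_polyhedron:
  assumes "finite C" "strict_set C \<noteq> {}" "\<And>v. v \<in> strict_set C \<Longrightarrow> \<not> int_vec v"
  obtains L where "split_polyhedron L" "strict_set C \<subseteq> interior L"
proof -
  obtain D where D: "finite D" "witnessed D" "\<forall>v\<in>strict_set D. \<not> int_vec v" "strict_set C \<subseteq> strict_set D"
    using extend_to_witnessed_aux[of C "{}"] assms by auto
  then have "split_polyhedron (sol_set D)"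
    using assms(2) by (intro witnessed_imp_split_polyhedron) auto
  moreover have "interior (sol_set D) = strict_set D"
    using D assms(2) by (intro interior_sol_set) auto
  ultimately show thesis
    using that D by blast
qed

section \<open>Primitive systems and rational projections\<close>

definition coeff_gcd :: "(int ^ 'n) \<times> int \<Rightarrow> int" where
  "coeff_gcd c = Gcd (insert (snd c) (range (($) (fst c))))"

definition prim :: "(int ^ 'n) \<times> int \<Rightarrow> (int ^ 'n) \<times> int" where
  "prim c = ((\<chi> i. fst c $ i div coeff_gcd c), snd c div coeff_gcd c)"

lemma coeff_gcd_dvd: "coeff_gcd c dvd fst c $ i" "coeff_gcd c dvd snd c"
  unfolding coeff_gcd_def by (rule Gcd_dvd; simp)+

lemma coeff_gcd_pos:
  assumes "fst c \<noteq> 0"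
  shows "0 < coeff_gcd c"
proof -
  obtain i where "fst c $ i \<noteq> 0"
    using assms by (auto simp: vec_eq_iff)
  then have "coeff_gcd c \<noteq> 0"
    using coeff_gcd_dvd(1)[of c i] by auto
  moreover have "0 \<le> coeff_gcd c"
    unfolding coeff_gcd_def by (rule Gcd_int_greater_eq_0)
  ultimately show ?thesis by simp
qed

lemma prim_mult:
  shows "fst c $ i = coeff_gcd c * fst (prim c) $ i" "snd c = coeff_gcd c * snd (prim c)"
  using coeff_gcd_dvd[of c] by (auto simp: prim_def)

lemma slack_prim: "slack c x = real_of_int (coeff_gcd c) * slack (prim c) x"
proof -
  have "real_vec (fst c) = real_of_int (coeff_gcd c) *\<^sub>R real_vec (fst (prim c))"
    using prim_mult(1)[of c] by (simp add: real_vec_def vec_eq_iff)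
  moreover have "real_of_int (snd c) = real_of_int (coeff_gcd c) * real_of_int (snd (prim c))"
    using prim_mult(2)[of c] by (metis of_int_mult)
  ultimately show ?thesis
    by (simp add: slack_def algebra_simps)
qed

lemma coeff_gcd_prim:
  assumes "fst c \<noteq> 0"
  shows "coeff_gcd (prim c) = 1"
proof -
  let ?g = "coeff_gcd c"
  have "insert (snd c) (range (($) (fst c))) = (*) ?g ` insert (snd (prim c)) (range (($) (fst (prim c))))"
    using prim_mult[of c] by (auto simp: image_iff)
  then have "?g = normalize (?g * coeff_gcd (prim c))"
    unfolding coeff_gcd_def[of "prim c"] by (metis Gcd_mult coeff_gcd_def)
  moreover have "0 < ?g" "0 \<le> coeff_gcd (prim c)"
    using coeff_gcd_pos[OF assms] by (auto simp: coeff_gcd_def Gcd_int_greater_eq_0)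
  ultimately show ?thesis
    by (simp add: abs_mult)
qed

lemma fst_prim_nonzero:
  assumes "fst c \<noteq> 0"
  shows "fst (prim c) \<noteq> 0"
proof
  assume "fst (prim c) = 0"
  then have "fst c $ i = 0" for i
    using prim_mult(1)[of c i] by simp
  with assms show False
    by (simp add: vec_eq_iff)
qed

text \<open>The factor \<open>t\<close> is the ratio of the absolute values of one nonzero
  coordinate. Cross-multiplying turns proportionality into identities of integers, and comparing
  gcds makes the two absolute values equal. This gives uniqueness of primitive facet
  inequalities.\<close>

lemma prim_proportional:
  assumes "coeff_gcd c = 1" "coeff_gcd d = 1" "0 < t"
    and "real_vec (fst c) = t *\<^sub>R real_vec (fst d)" "real_of_int (snd c) = t * real_of_int (snd d)"
    and "fst d \<noteq> 0"
  shows "c = d"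
proof -
  obtain i where i: "fst d $ i \<noteq> 0"
    using assms(6) by (auto simp: vec_eq_iff)
  have comp: "real_of_int (fst c $ j) = t * real_of_int (fst d $ j)" for j
    using assms(4) by (simp add: vec_eq_iff real_vec_def)
  define m n where "m = \<bar>fst c $ i\<bar>" and "n = \<bar>fst d $ i\<bar>"
  have n: "n > 0"
    using i by (simp add: n_def)
  have mt: "real_of_int m = t * real_of_int n"
    using comp[of i] assms(3) by (simp add: m_def n_def abs_mult)
  have "real_of_int (n * fst c $ j) = real_of_int (m * fst d $ j)" for j
    using comp[of j] mt by simp
  then have 1: "n * fst c $ j = m * fst d $ j" for j
    using of_int_eq_iff by blast
  have "real_of_int (n * snd c) = real_of_int (m * snd d)"
    using assms(5) mt by simp
  then have 2: "n * snd c = m * snd d"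
    using of_int_eq_iff by blast
  have "(*) n ` insert (snd c) (range (($) (fst c))) = (*) m ` insert (snd d) (range (($) (fst d)))"
    using 1 2 by (simp add: image_image)
  then have "normalize (n * coeff_gcd c) = normalize (m * coeff_gcd d)"
    unfolding coeff_gcd_def by (metis Gcd_mult)
  then have "n = m"
    using assms(1,2) by (simp add: m_def n_def)
  then show ?thesis
    using 1 2 n by (simp add: prod_eq_iff vec_eq_iff)
qed

section \<open>Rational polyhedra as integral systems\<close>

lemma common_denominator:
  fixes A :: "real set"
  assumes "finite A" "A \<subseteq> \<rat>"
  shows "\<exists>N::int. 0 < N \<and> (\<forall>x\<in>A. real_of_int N * x \<in> \<int>)"
  using assms
proof (induction A)
  case empty
  show ?case by (intro exI[of _ 1]) auto
next
  case (insert x A)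
  then obtain N where N: "0 < N" "\<forall>x\<in>A. real_of_int N * x \<in> \<int>"
    by auto
  obtain m n where "x = real_of_int m / real_of_int n" "0 < n"
    using insert.prems by (auto elim: Rats_cases')
  then have n: "0 < n" "real_of_int n * x \<in> \<int>"
    by auto
  have "real_of_int (N * n) * x \<in> \<int>"
    using Ints_mult[OF Ints_of_int[of N] n(2)] by (simp add: mult.assoc)
  moreover have "real_of_int (N * n) * y \<in> \<int>" if "y \<in> A" for y
    using Ints_mult[OF Ints_of_int[of n], of "real_of_int N * y"] N(2) that by (simp add: mult_ac)
  ultimately show ?case
    using N(1) n(1) by (intro exI[of _ "N * n"]) auto
qed

lemma int_vec_imp_real_vec:
  assumes "int_vec z"
  obtains a where "z = real_vec a"
proof
  show "z = real_vec (\<chi> i. \<lfloor>z $ i\<rfloor>)"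
    using assms by (simp add: vec_eq_iff real_vec_def int_vec_def)
qed

lemma int_vec_real_vec [simp]: "int_vec (real_vec a)"
  by (simp add: int_vec_def real_vec_def)

lemma rational_multiple_real_vec:
  assumes "rat_vec a"
  obtains N :: int and c where "0 < N" "real_vec c = real_of_int N *\<^sub>R a"
proof -
  have "finite (range (($) a))" "range (($) a) \<subseteq> \<rat>"
    using assms by (auto simp: rat_vec_def)
  then obtain N :: int where "0 < N" "\<forall>x\<in>range (($) a). real_of_int N * x \<in> \<int>"
    using common_denominator by metis
  then have "int_vec (real_of_int N *\<^sub>R a)"
    by (auto simp: int_vec_def)
  with \<open>0 < N\<close> show thesis
    using that int_vec_imp_real_vec by metis
qed

lemma rational_halfspace_slack:
  assumes "rat_vec a" "b \<in> \<rat>"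
  shows "\<exists>c. \<forall>z. a \<bullet> z \<le> b \<longleftrightarrow> 0 \<le> slack c z"
proof -
  have fin: "finite (insert b (range (($) a)))" "insert b (range (($) a)) \<subseteq> \<rat>"
    using assms by (auto simp: rat_vec_def)
  then obtain N :: int where N: "0 < N" "\<forall>x\<in>insert b (range (($) a)). real_of_int N * x \<in> \<int>"
    using common_denominator by metis
  then have "int_vec (- real_of_int N *\<^sub>R a)"
    by (auto simp: int_vec_def)
  then obtain c where c: "- real_of_int N *\<^sub>R a = real_vec c"
    using int_vec_imp_real_vec by metis
  obtain d where d: "real_of_int N * b = real_of_int d"
    using N(2) by (auto elim: Ints_cases)
  have "slack (c, - d) z = real_of_int N * (b - a \<bullet> z)" for z
    using c[symmetric] d by (simp add: slack_def algebra_simps)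
  then show ?thesis
    using N(1) by (intro exI[of _ "(c, - d)"]) (simp add: zero_le_mult_iff)
qed

lemma rational_polyhedron_imp_sol_set:
  assumes "rational_polyhedron S"
  obtains C where "finite C" "S = sol_set C"
proof -
  obtain D where D: "finite D" "\<forall>(a, b)\<in>D. rat_vec a \<and> b \<in> \<rat>" "S = {z. \<forall>(a, b)\<in>D. a \<bullet> z \<le> b}"
    using assms unfolding rational_polyhedron_def by blast
  then have "\<forall>e\<in>D. \<exists>c. \<forall>z. fst e \<bullet> z \<le> snd e \<longleftrightarrow> 0 \<le> slack c z"
    using rational_halfspace_slack by fastforce
  from bchoice[OF this] obtain f where "\<forall>e\<in>D. \<forall>z. fst e \<bullet> z \<le> snd e \<longleftrightarrow> 0 \<le> slack (f e) z"
    by blast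
  then have "S = sol_set (f ` D)"
    unfolding D(3) sol_set_def by (simp add: case_prod_beta)
  with D(1) show thesis
    using that by blast
qed

text \<open>If the hyperplane of an irredundant constraint carried no such lattice point, the constraint
  could be relaxed by one unit without admitting an interior lattice point, since slacks are
  integral on the lattice.\<close>

lemma split_polyhedron_imp_witnessed:
  assumes L: "split_polyhedron L" "interior L \<noteq> {}"
  obtains C where "finite C" "C \<noteq> {}" "witnessed C" "\<forall>c\<in>C. coeff_gcd c = 1"
    "L = sol_set C" "interior L = strict_set C" "\<forall>v\<in>strict_set C. \<not> int_vec v"
proof -
  obtain C0 where C0: "finite C0" "L = sol_set C0"
    using L rational_polyhedron_imp_sol_set by (metis split_polyhedron_def)
  obtain x0 where x0: "x0 \<in> interior L"
    using L by blast
  \<comment> \<open>Constraints with zero normal hold everywhere because they hold at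
    \<open>x0\<close>, so they are discarded before normalizing.\<close>
  define C1 where "C1 = prim ` {c \<in> C0. fst c \<noteq> 0}"
  have C1: "finite C1" "\<forall>c\<in>C1. coeff_gcd c = 1 \<and> fst c \<noteq> 0"
    using C0 by (auto simp: C1_def coeff_gcd_prim fst_prim_nonzero)
  have "0 \<le> slack c x \<longleftrightarrow> 0 \<le> slack (prim c) x" if "fst c \<noteq> 0" for c :: "(int ^ 'a) \<times> int" and x
    using coeff_gcd_pos[OF that] slack_prim[of c x] by (simp add: zero_le_mult_iff)
  moreover have "0 \<le> slack c x" if "c \<in> C0" "fst c = 0" for c x
  proof -
    have "0 \<le> slack c x0"
      using x0 interior_subset C0 that by (auto simp: sol_set_def)
    then show ?thesis
      using that by (simp add: slack_def real_vec_def inner_vec_def)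
  qed
  ultimately have LC1: "L = sol_set C1"
    unfolding C0(2) C1_def sol_set_def by blast
  \<comment> \<open>An inclusion-minimal subsystem: its irredundancy later supplies a point
    \<open>y\<close> that violates \<open>c\<close> and no other constraint.\<close>
  obtain C where C: "C \<subseteq> C1" "L = sol_set C" "\<And>D. D \<subset> C \<Longrightarrow> sol_set D \<noteq> L"
  proof -
    define X where "X = {D. D \<subseteq> C1 \<and> L = sol_set D}"
    have "finite X" "C1 \<in> X"
      using C1 LC1 by (auto simp: X_def)
    from finite_has_minimal2[OF this] obtain C where C: "C \<in> X" "\<forall>D\<in>X. D \<subseteq> C \<longrightarrow> C = D"
      by blast
    have "sol_set D \<noteq> L" if "D \<subset> C" for D
      using C that by (auto simp: X_def)
    with C(1) show thesis
      using that[of C] by (simp add: X_def)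
  qed
  have fin: "finite C"
    using C C1 finite_subset by blast
  have "0 < slack c x" if "c \<in> C" "x \<in> interior L" for c x
  proof -
    have "fst c \<noteq> 0"
      using C C1 that by blast
    then have ne: "real_vec (fst c) \<noteq> 0"
      by (auto simp: real_vec_def vec_eq_iff)
    have "L \<subseteq> {x. real_vec (fst c) \<bullet> x \<ge> real_of_int (snd c)}"
      using that C by (auto simp: sol_set_def slack_def)
    then have "interior L \<subseteq> {x. real_vec (fst c) \<bullet> x > real_of_int (snd c)}"
      using interior_mono interior_halfspace_ge[OF ne] by metis
    then show ?thesis
      using that by (auto simp: slack_def)
  qed
  then have "x0 \<in> strict_set C"
    using x0 by (auto simp: strict_set_def)
  then have strict: "strict_set C \<noteq> {}"
    by blast
  have int: "interior L = strict_set C"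
    using C fin strict interior_sol_set by blast
  have free: "\<forall>v\<in>strict_set C. \<not> int_vec v"
    using L C fin strict lattice_point_free_sol_set by (metis split_polyhedron_def)
  have "C \<noteq> {}"
  proof
    assume "C = {}"
    then have "(0::real ^ 'a) \<in> strict_set C"
      by (simp add: strict_set_def)
    with free show False
      by (force simp: int_vec_def)
  qed
  moreover have "witnessed C"
    unfolding witnessed_def
  proof (rule ccontr)
    assume "\<not> (\<forall>c\<in>C. \<exists>v. int_vec v \<and> slack c v = 0 \<and> v \<in> strict_set (C - {c}))"
    then obtain c where c: "c \<in> C" and no: "\<And>v. int_vec v \<Longrightarrow> slack c v = 0 \<Longrightarrow> v \<notin> strict_set (C - {c})"
      by blast
    define c' where "c' = (fst c, snd c - 1)"
    have slack': "slack c' x = slack c x + 1" for x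
      by (simp add: c'_def slack_def)
    define D where "D = insert c' (C - {c})"
    have LD: "L \<subseteq> sol_set D"
      using C slack' c by (fastforce simp: D_def sol_set_def)
    have "strict_set C \<subseteq> strict_set D"
      using slack' c by (fastforce simp: D_def strict_set_def)
    moreover have "\<not> int_vec v" if v: "v \<in> strict_set D" for v
    proof
      assume iv: "int_vec v"
      have vR: "v \<in> strict_set (C - {c})" "0 < slack c v + 1"
        using v slack' by (auto simp: D_def strict_set_def)
      then have "0 < slack c v \<or> slack c v = 0"
        using Ints_slack[OF iv, of c] by (auto elim!: Ints_cases)
      moreover have "v \<in> strict_set C" if "0 < slack c v"
        using vR that by (auto simp: strict_set_def)
      ultimately show False
        using free no iv vR by blast
    qed
    ultimately have "lattice_point_free (sol_set D)"
      using strict fin lattice_point_free_sol_set[of D] by (auto simp: D_def)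
    then have eq: "sol_set D = L"
      using L LD by (auto simp: split_polyhedron_def)
    have "C - {c} \<subset> C"
      using c by blast
    then have "sol_set (C - {c}) \<noteq> sol_set C"
      using C(2,3) by metis
    moreover have "sol_set C \<subseteq> sol_set (C - {c})"
      by (auto simp: sol_set_def)
    ultimately obtain y where y: "y \<in> sol_set (C - {c})" "y \<notin> sol_set C"
      by blast
    then have neg: "slack c y < 0"
      by (force simp: sol_set_def)
    have pos: "0 < slack c x0"
      using \<open>x0 \<in> strict_set C\<close> c by (auto simp: strict_set_def)
    \<comment> \<open>Moving from \<open>x0\<close> towards \<open>y\<close> until the slack of
      \<open>c\<close> is \<open>-1/2\<close>, or stopping at \<open>y\<close> if the slack is still
      larger there, gives a point that violates \<open>c\<close> but satisfies the constraint
      relaxed by one unit.\<close>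
    define t where "t = min 1 ((slack c x0 + 1/2) / (slack c x0 - slack c y))"
    have t: "0 \<le> t" "t \<le> 1"
      using neg pos by (auto simp: t_def)
    define w where "w = (1 - t) *\<^sub>R x0 + t *\<^sub>R y"
    have "slack c w = slack c x0 - t * (slack c x0 - slack c y)"
      unfolding w_def by (subst slack_affine) (simp_all add: algebra_simps)
    moreover have "t * (slack c x0 - slack c y) \<le> slack c x0 + 1/2"
    proof -
      have "t \<le> (slack c x0 + 1/2) / (slack c x0 - slack c y)"
        by (simp add: t_def)
      then show ?thesis
        using neg pos by (simp add: pos_le_divide_eq)
    qed
    moreover have "slack c x0 < t * (slack c x0 - slack c y)"
    proof (cases "t = 1")
      case True
      then show ?thesis using neg by simp
    next
      case False
      then have "t = (slack c x0 + 1/2) / (slack c x0 - slack c y)"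
        by (auto simp: t_def min_def split: if_splits)
      then have "t * (slack c x0 - slack c y) = slack c x0 + 1/2"
        using neg pos by simp
      then show ?thesis by simp
    qed
    ultimately have w: "- 1 \<le> slack c w" "slack c w < 0"
      by auto
    have "w \<in> sol_set (C - {c})"
      unfolding w_def using convex_sol_set y(1) \<open>x0 \<in> strict_set C\<close> strict_set_subset t
      by (intro convexD) (auto simp: strict_set_def sol_set_def less_imp_le)
    then have "w \<in> sol_set D"
      using w slack' by (auto simp: D_def sol_set_def)
    with eq C w c show False
      by (force simp: sol_set_def)
  qed
  ultimately show thesis
    using that[of C] C C1 fin int free by blast
qed

section \<open>Elimination of coordinates\<close>

lemma finite_interval_nonempty:
  fixes A B :: "real set"
  assumes "finite A" "finite B" "\<And>a b. a \<in> A \<Longrightarrow> b \<in> B \<Longrightarrow> a \<le> b"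
  shows "\<exists>t. (\<forall>a\<in>A. a \<le> t) \<and> (\<forall>b\<in>B. t \<le> b)"
proof (cases "A = {}")
  case True
  then show ?thesis
    using assms(2) by (cases "B = {}") (auto intro!: exI[of _ "Min B"])
next
  case False
  then show ?thesis
    using assms by (intro exI[of _ "Max A"]) auto
qed

text \<open>Fourier--Motzkin elimination of the coordinate \<open>j\<close>.\<close>

lemma rational_polyhedron_eliminate:
  fixes S :: "(real ^ 'n) set"
  assumes "rational_polyhedron S"
  shows "rational_polyhedron {z. \<exists>t. z + t *\<^sub>R axis j 1 \<in> S}"
proof -
  obtain C where C: "finite C" "\<forall>(a, b)\<in>C. rat_vec a \<and> b \<in> \<rat>" "S = {z. \<forall>(a, b)\<in>C. a \<bullet> z \<le> b}"
    using assms unfolding rational_polyhedron_def by blast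
  \<comment> \<open>Each constraint in \<open>Up\<close> bounds the step \<open>t\<close> from above
    and each one in \<open>Lo\<close> from below. The scaling makes the coefficients of coordinate
    \<open>j\<close> cancel, which expresses that the lower bound does not exceed the upper
    one.\<close>
  define f :: "((real ^ 'n) \<times> real) \<times> ((real ^ 'n) \<times> real) \<Rightarrow> (real ^ 'n) \<times> real" where
    "f = (\<lambda>((a, b), (a', b')). ((1 / a $ j) *\<^sub>R a - (1 / a' $ j) *\<^sub>R a', b / a $ j - b' / a' $ j))"
  define Z where "Z = {c \<in> C. fst c $ j = 0}"
  define Up where "Up = {c \<in> C. fst c $ j > 0}"
  define Lo where "Lo = {c \<in> C. fst c $ j < 0}"
  define D where "D = Z \<union> f ` (Up \<times> Lo)"
  have "finite D"
    using C(1) by (simp add: D_def Z_def Up_def Lo_def)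
  moreover have "\<forall>(a, b)\<in>D. rat_vec a \<and> b \<in> \<rat>"
  proof -
    have rat: "rat_vec (fst c)" "snd c \<in> \<rat>" if "c \<in> C" for c
      using C(2) that by auto
    have "rat_vec (fst (f (c, d)))" "snd (f (c, d)) \<in> \<rat>" if "c \<in> C" "d \<in> C" for c d
      using rat[OF that(1)] rat[OF that(2)] by (auto simp: f_def case_prod_beta rat_vec_def)
    with rat have "\<forall>e\<in>D. rat_vec (fst e) \<and> snd e \<in> \<rat>"
      unfolding D_def Z_def Up_def Lo_def by blast
    then show ?thesis
      by auto
  qed
  moreover have "(\<exists>t. z + t *\<^sub>R axis j 1 \<in> S) \<longleftrightarrow> (\<forall>(a, b)\<in>D. a \<bullet> z \<le> b)" for z
  proof
    assume "\<exists>t. z + t *\<^sub>R axis j 1 \<in> S"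
    then obtain t where "\<forall>c\<in>C. fst c \<bullet> (z + t *\<^sub>R axis j 1) \<le> snd c"
      unfolding C(3) by (auto simp: case_prod_beta)
    then have t: "fst c \<bullet> z + t * fst c $ j \<le> snd c" if "c \<in> C" for c
      using that by (auto simp: inner_add_right inner_axis)
    have "fst c \<bullet> z \<le> snd c" if "c \<in> Z" for c
      using t[of c] that by (simp add: Z_def)
    moreover have "fst (f (c, d)) \<bullet> z \<le> snd (f (c, d))" if "c \<in> Up" "d \<in> Lo" for c d
    proof -
      have "t \<le> (snd c - fst c \<bullet> z) / fst c $ j"
        using t[of c] that by (simp add: Up_def pos_le_divide_eq)
      moreover have "(snd d - fst d \<bullet> z) / fst d $ j \<le> t"
        using t[of d] that by (simp add: Lo_def neg_divide_le_eq)
      ultimately have "(snd d - fst d \<bullet> z) / fst d $ j \<le> (snd c - fst c \<bullet> z) / fst c $ j"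
        by linarith
      then show ?thesis
        by (simp add: f_def case_prod_beta inner_diff_left diff_divide_distrib)
    qed
    ultimately have "\<forall>e\<in>D. fst e \<bullet> z \<le> snd e"
      unfolding D_def by blast
    then show "\<forall>(a, b)\<in>D. a \<bullet> z \<le> b"
      by auto
  next
    assume "\<forall>(a, b)\<in>D. a \<bullet> z \<le> b"
    then have D: "fst c \<bullet> z \<le> snd c" if "c \<in> D" for c
      using that by auto
    let ?h = "\<lambda>c. (snd c - fst c \<bullet> z) / fst c $ j"
    have "?h d \<le> ?h c" if "c \<in> Up" "d \<in> Lo" for c d
    proof -
      have "fst (f (c, d)) \<bullet> z \<le> snd (f (c, d))"
        using D[of "f (c, d)"] that by (auto simp: D_def)
      then show ?thesis
        by (simp add: f_def case_prod_beta inner_diff_left diff_divide_distrib)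
    qed
    moreover have "finite (?h ` Lo)" "finite (?h ` Up)"
      using C(1) by (auto simp: Lo_def Up_def)
    ultimately have "\<exists>t. (\<forall>x\<in>?h ` Lo. x \<le> t) \<and> (\<forall>x\<in>?h ` Up. t \<le> x)"
      by (intro finite_interval_nonempty) blast+
    then obtain t where t: "\<forall>x\<in>?h ` Lo. x \<le> t" "\<forall>x\<in>?h ` Up. t \<le> x"
      by blast
    have "fst c \<bullet> z + t * fst c $ j \<le> snd c" if "c \<in> C" for c
    proof -
      consider "c \<in> Z" | "c \<in> Up" | "c \<in> Lo"
        using \<open>c \<in> C\<close> by (fastforce simp: Z_def Up_def Lo_def)
      then show ?thesis
      proof cases
        case 1
        then show ?thesis using D[of c] by (simp add: D_def Z_def)
      next
        case 2
        then have "t \<le> ?h c" "fst c $ j > 0" using t by (auto simp: Up_def)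
        then show ?thesis by (simp add: pos_le_divide_eq)
      next
        case 3
        then have "?h c \<le> t" "fst c $ j < 0" using t by (auto simp: Lo_def)
        then show ?thesis by (simp add: neg_divide_le_eq)
      qed
    qed
    then show "\<exists>t. z + t *\<^sub>R axis j 1 \<in> S"
      unfolding C(3) by (auto simp: inner_add_right inner_axis intro!: exI[of _ t])
  qed
  then have "{z. \<exists>t. z + t *\<^sub>R axis j 1 \<in> S} = {z. \<forall>(a, b)\<in>D. a \<bullet> z \<le> b}"
    by (rule Collect_cong)
  ultimately show ?thesis
    unfolding rational_polyhedron_def by (intro exI[of _ D] conjI)
qed

text \<open>Coordinates are freed instead of dropped, so the ambient space stays the same throughout
  the induction.\<close>

lemma rational_polyhedron_eliminate_set:
  fixes S :: "(real ^ 'n) set"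
  assumes "rational_polyhedron S" "finite J"
  shows "rational_polyhedron {z. \<exists>w\<in>S. \<forall>i. i \<notin> J \<longrightarrow> w $ i = z $ i}"
  using assms(2)
proof (induction J)
  case empty
  have "{z. \<exists>w\<in>S. \<forall>i. i \<notin> {} \<longrightarrow> w $ i = z $ i} = S"
    by (auto simp: vec_eq_iff[symmetric])
  with assms(1) show ?case by simp
next
  case (insert j J)
  have "(\<exists>w\<in>S. \<forall>i. i \<notin> insert j J \<longrightarrow> w $ i = z $ i) \<longleftrightarrow>
        (\<exists>t. \<exists>w\<in>S. \<forall>i. i \<notin> J \<longrightarrow> w $ i = (z + t *\<^sub>R axis j 1) $ i)" for z
  proof
    assume "\<exists>w\<in>S. \<forall>i. i \<notin> insert j J \<longrightarrow> w $ i = z $ i"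
    then obtain w where "w \<in> S" "\<forall>i. i \<notin> insert j J \<longrightarrow> w $ i = z $ i"
      by blast
    then show "\<exists>t. \<exists>w\<in>S. \<forall>i. i \<notin> J \<longrightarrow> w $ i = (z + t *\<^sub>R axis j 1) $ i"
      by (intro exI[of _ "w $ j - z $ j"] bexI[of _ w]) (auto simp: axis_def)
  next
    assume "\<exists>t. \<exists>w\<in>S. \<forall>i. i \<notin> J \<longrightarrow> w $ i = (z + t *\<^sub>R axis j 1) $ i"
    then obtain t w where w: "w \<in> S" "\<forall>i. i \<notin> J \<longrightarrow> w $ i = (z + t *\<^sub>R axis j 1) $ i"
      by blast
    then have "\<forall>i. i \<notin> insert j J \<longrightarrow> w $ i = z $ i"
      by (simp add: axis_def)
    with w(1) show "\<exists>w\<in>S. \<forall>i. i \<notin> insert j J \<longrightarrow> w $ i = z $ i"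
      by blast
  qed
  then show ?case
    using rational_polyhedron_eliminate[OF insert.IH, of j] by simp
qed

text \<open>For injective \<open>\<iota>\<close> this is a section of \<open>xpart \<iota>\<close>
  and also its adjoint. The entry type is generic because both integral normals and real points are
  embedded.\<close>

definition coord_emb :: "('p::finite \<Rightarrow> 'n::finite) \<Rightarrow> 'a::zero ^ 'p \<Rightarrow> 'a ^ 'n" where
  "coord_emb \<iota> x = (\<chi> j. if j \<in> range \<iota> then x $ inv \<iota> j else 0)"

lemma coord_emb_nth [simp]: "inj \<iota> \<Longrightarrow> coord_emb \<iota> x $ \<iota> i = x $ i"
  by (simp add: coord_emb_def)

lemma xpart_coord_emb [simp]: "inj \<iota> \<Longrightarrow> xpart \<iota> (coord_emb \<iota> x) = x"
  by (simp add: xpart_def)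

lemma real_vec_coord_emb: "real_vec (coord_emb \<iota> a) = coord_emb \<iota> (real_vec a)"
  by (simp add: real_vec_def coord_emb_def vec_eq_iff)

lemma inner_coord_emb:
  assumes "inj \<iota>"
  shows "coord_emb \<iota> x \<bullet> z = x \<bullet> xpart \<iota> z"
proof -
  have "coord_emb \<iota> x \<bullet> z = (\<Sum>j\<in>range \<iota>. coord_emb \<iota> x $ j * z $ j)"
    unfolding inner_vec_def inner_real_def
    by (intro sum.mono_neutral_right) (auto simp: coord_emb_def)
  also have "\<dots> = (\<Sum>i\<in>UNIV. coord_emb \<iota> x $ \<iota> i * z $ \<iota> i)"
    using sum.reindex[OF assms, of "\<lambda>j. coord_emb \<iota> x $ j * z $ j"] by simp
  finally show ?thesis
    using assms by (simp add: inner_vec_def xpart_def)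
qed

lemma linear_xpart: "linear (xpart \<iota>)"
  by (auto intro!: linearI simp: xpart_def vec_eq_iff)

lemma surj_xpart: "inj \<iota> \<Longrightarrow> surj (xpart \<iota>)"
  by (metis surjI xpart_coord_emb)

text \<open>Freeing the coordinates outside \<open>range \<iota>\<close> gives the cylinder over the
  projection; evaluating its inequalities at embedded points then leaves only the coordinates of
  \<open>x\<close>.\<close>

lemma rational_polyhedron_xpart:
  fixes \<iota> :: "'p::finite \<Rightarrow> 'n::finite"
  assumes "inj \<iota>" "rational_polyhedron S"
  shows "rational_polyhedron (xpart \<iota> ` S)"
proof -
  have "rational_polyhedron {z. \<exists>w\<in>S. \<forall>i. i \<notin> - range \<iota> \<longrightarrow> w $ i = z $ i}" (is "rational_polyhedron ?T")
    using assms(2) by (intro rational_polyhedron_eliminate_set) auto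
  then obtain C where C: "finite C" "\<forall>(a, b)\<in>C. rat_vec a \<and> b \<in> \<rat>" "?T = {z. \<forall>(a, b)\<in>C. a \<bullet> z \<le> b}"
    unfolding rational_polyhedron_def by blast
  let ?D = "(\<lambda>(a, b). (xpart \<iota> a, b)) ` C"
  have "x \<in> xpart \<iota> ` S \<longleftrightarrow> (\<forall>(a, b)\<in>?D. a \<bullet> x \<le> b)" for x
  proof -
    have "(\<forall>i. i \<notin> - range \<iota> \<longrightarrow> w $ i = coord_emb \<iota> x $ i) \<longleftrightarrow> x = xpart \<iota> w" for w
      using coord_emb_nth[OF assms(1), of x] by (auto simp: xpart_def vec_eq_iff)
    then have "x \<in> xpart \<iota> ` S \<longleftrightarrow> coord_emb \<iota> x \<in> ?T"
      by auto
    also have "\<dots> \<longleftrightarrow> (\<forall>(a, b)\<in>C. a \<bullet> coord_emb \<iota> x \<le> b)"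
      using C(3) by blast
    also have "\<dots> \<longleftrightarrow> (\<forall>(a, b)\<in>?D. a \<bullet> x \<le> b)"
      using inner_coord_emb[OF assms(1), of x] by (auto simp: inner_commute)
    finally show ?thesis .
  qed
  then have "xpart \<iota> ` S = {x. \<forall>(a, b)\<in>?D. a \<bullet> x \<le> b}"
    by blast
  moreover have "\<forall>(a, b)\<in>?D. rat_vec a \<and> b \<in> \<rat>"
    using C(2) by (auto simp: rat_vec_def xpart_def)
  moreover have "finite ?D"
    using C(1) by simp
  ultimately show ?thesis
    unfolding rational_polyhedron_def by (intro exI[of _ ?D] conjI)
qed

lemma rational_polyhedron_proj_level:
  assumes "inj \<iota>" "rational_polyhedron P" "rat_vec \<delta>" "\<delta>0 \<in> \<rat>"
  shows "rational_polyhedron (proj_level \<iota> P \<delta> \<delta>0)"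
proof -
  obtain C where C: "finite C" "\<forall>(a, b)\<in>C. rat_vec a \<and> b \<in> \<rat>" "P = {z. \<forall>(a, b)\<in>C. a \<bullet> z \<le> b}"
    using assms(2) unfolding rational_polyhedron_def by blast
  then have "rational_polyhedron {z \<in> P. \<delta> \<bullet> z \<le> \<delta>0}"
    unfolding rational_polyhedron_def using assms(3,4)
    by (intro exI[of _ "insert (\<delta>, \<delta>0) C"]) auto
  then show ?thesis
    unfolding proj_level_def using assms(1) by (intro rational_polyhedron_xpart)
qed

section \<open>Facets and widths of split polyhedra\<close>

text \<open>Near its witness the hyperplane of \<open>c\<close> is cut by no other constraint. The
  face therefore contains a relatively open piece of the hyperplane and has codimension one.\<close>

lemma facet_of_sol_set:
  fixes C :: "((int ^ 'n) \<times> int) set"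
  assumes C: "finite C" "strict_set C \<noteq> {}" "witnessed C" "c \<in> C"
  shows "(sol_set C \<inter> {x. real_vec (fst c) \<bullet> x = real_of_int (snd c)}) facet_of sol_set C"
proof -
  let ?H = "{x. real_vec (fst c) \<bullet> x = real_of_int (snd c)}"
  let ?G = "sol_set C \<inter> ?H"
  obtain x0 where x0: "x0 \<in> strict_set C"
    using C by blast
  obtain v where v: "slack c v = 0" "v \<in> strict_set (C - {c})"
    using C unfolding witnessed_def by blast
  have ne: "real_vec (fst c) \<noteq> 0"
  proof
    assume "real_vec (fst c) = 0"
    then have "slack c v = slack c x0"
      by (simp add: slack_def)
    with v x0 C(4) show False
      by (auto simp: strict_set_def)
  qed
  have sub: "?H \<inter> strict_set (C - {c}) \<subseteq> ?G"
    by (force simp: sol_set_def strict_set_def slack_def)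
  have vH: "v \<in> ?H \<inter> strict_set (C - {c})"
    using v by (simp add: slack_def)
  have "affine hull (?H \<inter> strict_set (C - {c})) = affine hull ?H"
    using vH C by (intro affine_hull_affine_Int_open affine_hyperplane open_strict_set) auto
  then have "aff_dim ?H \<le> aff_dim ?G"
    using sub by (metis aff_dim_affine_hull aff_dim_subset)
  moreover have "aff_dim ?G \<le> aff_dim ?H"
    by (intro aff_dim_subset) auto
  moreover have "interior (sol_set C) \<noteq> {}"
    using interior_sol_set C by blast
  then have "aff_dim (sol_set C) = int (DIM(real ^ 'n))"
    by (simp add: aff_dim_nonempty_interior)
  ultimately have "aff_dim ?G = aff_dim (sol_set C) - 1"
    using aff_dim_hyperplane[OF ne, of "real_of_int (snd c)"] by simp
  moreover have "?G face_of sol_set C"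
    using C(4) by (intro face_of_Int_supporting_hyperplane_ge convex_sol_set)
      (auto simp: sol_set_def slack_def)
  ultimately show ?thesis
    unfolding facet_of_def using vH sub by blast
qed

lemma hyperplane_subset_imp_proportional:
  fixes a b :: "'a::real_inner"
  assumes "a \<noteq> 0" "{x. a \<bullet> x = r} \<subseteq> {x. b \<bullet> x = s}"
  obtains t where "b = t *\<^sub>R a" "s = t * r"
proof -
  \<comment> \<open>\<open>v\<close> is the point of the first hyperplane closest to the origin, and
    \<open>d\<close> is a multiple of the component of \<open>b\<close> orthogonal to
    \<open>a\<close>. Moving along \<open>d\<close> stays in the hyperplane, so \<open>b\<close> is
    orthogonal to \<open>d\<close> as well, and \<open>d\<close> vanishes.\<close>
  define v where "v = (r / (a \<bullet> a)) *\<^sub>R a"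
  define d where "d = (a \<bullet> a) *\<^sub>R b - (b \<bullet> a) *\<^sub>R a"
  have ad: "a \<bullet> d = 0"
    by (simp add: d_def inner_diff_right inner_commute)
  have av: "a \<bullet> v = r"
    using assms(1) by (simp add: v_def)
  moreover have "a \<bullet> (v + d) = r"
    using av ad by (simp add: inner_add_right)
  ultimately have bv: "b \<bullet> v = s" "b \<bullet> (v + d) = s"
    using assms(2) by blast+
  then have "b \<bullet> d = 0"
    by (simp add: inner_add_right)
  have "d \<bullet> d = (a \<bullet> a) * (b \<bullet> d) - (b \<bullet> a) * (a \<bullet> d)"
    by (subst (1) d_def) (simp add: inner_diff_left)
  then have "d = 0"
    using ad \<open>b \<bullet> d = 0\<close> by simp
  then have "(1 / (a \<bullet> a)) *\<^sub>R ((a \<bullet> a) *\<^sub>R b) = (1 / (a \<bullet> a)) *\<^sub>R ((b \<bullet> a) *\<^sub>R a)"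
    by (simp add: d_def)
  then have b: "b = ((b \<bullet> a) / (a \<bullet> a)) *\<^sub>R a"
    using assms(1) by simp
  moreover have "s = (b \<bullet> a) / (a \<bullet> a) * r"
    using bv(1) by (simp add: v_def mult.commute)
  ultimately show thesis
    using that by blast
qed

text \<open>A relatively interior point \<open>g\<close> of the facet is tight for some
  \<open>c\<close>. Extending segments through \<open>g\<close> makes \<open>c\<close> tight on the
  whole facet, and by dimension the hyperplane of \<open>c\<close> is its affine hull.\<close>

lemma facet_of_sol_set_proportional:
  fixes C :: "((int ^ 'n) \<times> int) set"
  assumes C: "finite C" "strict_set C \<noteq> {}" "\<forall>c\<in>C. fst c \<noteq> 0"
    and sub: "sol_set C \<subseteq> {x. s \<le> p \<bullet> x}"
    and facet: "(sol_set C \<inter> {x. p \<bullet> x = s}) facet_of sol_set C"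
  obtains c t where "c \<in> C" "0 \<le> t" "p = t *\<^sub>R real_vec (fst c)" "s = t * real_of_int (snd c)"
proof -
  let ?G = "sol_set C \<inter> {x. p \<bullet> x = s}"
  have G: "convex ?G" "?G \<noteq> {}" "aff_dim ?G = aff_dim (sol_set C) - 1"
    using facet convex_sol_set by (auto simp: facet_of_def intro!: convex_Int convex_hyperplane)
  have int: "interior (sol_set C) = strict_set C"
    using C interior_sol_set by blast
  then have dim: "aff_dim (sol_set C) = int (DIM(real ^ 'n))"
    using C by (simp add: aff_dim_nonempty_interior)
  obtain g where g: "g \<in> rel_interior ?G"
    using G(1,2) rel_interior_eq_empty by blast
  then have gG: "g \<in> ?G"
    using rel_interior_subset by blast
  have "g \<notin> strict_set C"
  proof
    assume gs: "g \<in> strict_set C"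
    have "p = 0"
    proof (rule ccontr)
      assume "p \<noteq> 0"
      then have "interior (sol_set C) \<subseteq> {x. s < p \<bullet> x}"
        using sub interior_mono interior_halfspace_ge by metis
      with gs gG int show False
        by auto
    qed
    with gG have "?G = sol_set C"
      by auto
    with G(3) show False
      by simp
  qed
  then obtain c where c: "c \<in> C" "slack c g = 0"
    using gG by (force simp: strict_set_def sol_set_def)
  let ?H = "{x. real_vec (fst c) \<bullet> x = real_of_int (snd c)}"
  have "slack c y = 0" if y: "y \<in> ?G" for y
  proof -
    obtain e where e: "e > 0" "g + e *\<^sub>R (g - y) \<in> ?G"
      using rel_interior_extend[OF G(1) g y] by blast
    then have "0 \<le> slack c (g + e *\<^sub>R (g - y))" "0 \<le> slack c y"
      using c y by (auto simp: sol_set_def)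
    then show ?thesis
      using e(1) c(2) unfolding slack_extend by (simp add: mult_le_0_iff)
  qed
  then have GH: "?G \<subseteq> ?H"
    by (auto simp: slack_def)
  have ne: "real_vec (fst c) \<noteq> 0"
    using C(3) c(1) by (auto simp: real_vec_def vec_eq_iff)
  have "aff_dim ?H \<le> aff_dim ?G"
    using G(3) dim aff_dim_hyperplane[OF ne] by simp
  then have "affine hull ?G = affine hull ?H"
    using aff_dim_eq_full_gen[OF GH] aff_dim_subset[OF GH] by simp
  moreover have "affine hull ?G \<subseteq> {x. p \<bullet> x = s}"
    by (intro hull_minimal affine_hyperplane) auto
  moreover have "affine hull ?H = ?H"
    by (simp add: affine_hyperplane)
  ultimately have "?H \<subseteq> {x. p \<bullet> x = s}"
    by simp
  then obtain t where t: "p = t *\<^sub>R real_vec (fst c)" "s = t * real_of_int (snd c)"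
    using hyperplane_subset_imp_proportional[OF ne] by metis
  obtain x0 where x0: "x0 \<in> strict_set C"
    using C by blast
  then have "s \<le> p \<bullet> x0"
    using sub strict_set_subset by blast
  then have "0 \<le> t * slack c x0"
    using t by (simp add: slack_def algebra_simps)
  moreover have "0 < slack c x0"
    using x0 c by (simp add: strict_set_def)
  ultimately have "0 \<le> t"
    by (simp add: zero_le_mult_iff)
  with t c that show thesis
    by blast
qed

section \<open>Facet inequalities of cylinders\<close>

definition emb_ineq :: "('p::finite \<Rightarrow> 'n::finite) \<Rightarrow> (int ^ 'p) \<times> int \<Rightarrow> (int ^ 'n) \<times> int" where
  "emb_ineq \<iota> c = (coord_emb \<iota> (fst c), snd c)"

lemma slack_emb_ineq: "inj \<iota> \<Longrightarrow> slack (emb_ineq \<iota> c) z = slack c (xpart \<iota> z)"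
  by (simp add: slack_def emb_ineq_def real_vec_coord_emb inner_coord_emb)

lemma cylinder_sol_set: "inj \<iota> \<Longrightarrow> cylinder \<iota> (sol_set C) = sol_set (emb_ineq \<iota> ` C)"
  by (auto simp: cylinder_def sol_set_def slack_emb_ineq)

lemma int_vec_coord_emb: "int_vec x \<Longrightarrow> int_vec (coord_emb \<iota> x)"
  by (simp add: int_vec_def coord_emb_def)

lemma witnessed_emb_ineq:
  assumes "inj \<iota>" "witnessed C"
  shows "witnessed (emb_ineq \<iota> ` C)"
  unfolding witnessed_def
proof
  fix d assume "d \<in> emb_ineq \<iota> ` C"
  then obtain c where c: "c \<in> C" "d = emb_ineq \<iota> c"
    by blast
  then obtain v where v: "int_vec v" "slack c v = 0" "v \<in> strict_set (C - {c})"
    using assms(2) unfolding witnessed_def by blast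
  then have "slack d (coord_emb \<iota> v) = 0"
    using assms(1) c by (simp add: slack_emb_ineq)
  moreover have "coord_emb \<iota> v \<in> strict_set (emb_ineq \<iota> ` C - {d})"
    using assms(1) c v by (auto simp: strict_set_def slack_emb_ineq)
  ultimately show "\<exists>w. int_vec w \<and> slack d w = 0 \<and> w \<in> strict_set (emb_ineq \<iota> ` C - {d})"
    using v(1) int_vec_coord_emb by blast
qed

lemma witnessed_nonzero:
  assumes "witnessed C" "strict_set C \<noteq> {}" "c \<in> C"
  shows "fst c \<noteq> 0"
proof
  assume "fst c = 0"
  then have const: "slack c x = - real_of_int (snd c)" for x
    by (simp add: slack_def real_vec_def inner_vec_def)
  obtain v where "slack c v = 0"
    using assms unfolding witnessed_def by blast
  moreover obtain x where "0 < slack c x"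
    using assms by (auto simp: strict_set_def)
  ultimately show False
    using const by simp
qed

text \<open>Every constraint cuts out a facet thanks to its witness. Conversely a facet inequality
  is a multiple of a constraint, and primitivity on both sides leaves only the factor 1. The maximum
  defining the width thus runs over the system itself.\<close>

lemma facet_ineqs_cylinder:
  fixes \<iota> :: "'p::finite \<Rightarrow> 'n::finite"
  assumes \<iota>: "inj \<iota>"
    and C: "finite C" "strict_set C \<noteq> {}" "witnessed C" "\<forall>c\<in>C. coeff_gcd c = 1"
  shows "facet_ineqs \<iota> (cylinder \<iota> (sol_set C)) = emb_ineq \<iota> ` C"
proof -
  let ?D = "emb_ineq \<iota> ` C"
  obtain x0 where x0: "x0 \<in> strict_set C"
    using C by blast
  then have "coord_emb \<iota> x0 \<in> strict_set ?D"
    using \<iota> by (auto simp: strict_set_def slack_emb_ineq)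
  then have D: "finite ?D" "strict_set ?D \<noteq> {}" "witnessed ?D"
    using C \<iota> witnessed_emb_ineq by auto
  then have D0: "\<forall>d\<in>?D. fst d \<noteq> 0"
    using witnessed_nonzero by blast
  have gcd: "Gcd (insert (snd d) (range (\<lambda>i. fst d $ \<iota> i))) = 1" if "d \<in> ?D" for d
    using that C(4) \<iota> by (auto simp: emb_ineq_def coeff_gcd_def)
  show ?thesis
  proof (intro equalityI subsetI)
    fix d assume d: "d \<in> ?D"
    then have "sol_set ?D \<subseteq> {z. real_of_int (snd d) \<le> real_vec (fst d) \<bullet> z}"
      by (auto simp: sol_set_def slack_def)
    moreover have "\<forall>j. j \<notin> range \<iota> \<longrightarrow> fst d $ j = 0"
      using d by (auto simp: emb_ineq_def coord_emb_def)
    ultimately show "d \<in> facet_ineqs \<iota> (cylinder \<iota> (sol_set C))"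
      unfolding facet_ineqs_def cylinder_sol_set[OF \<iota>]
      using facet_of_sol_set[OF D d] gcd[OF d] by (simp add: case_prod_beta)
  next
    fix e assume "e \<in> facet_ineqs \<iota> (cylinder \<iota> (sol_set C))"
    then have e: "sol_set ?D \<subseteq> {z. real_of_int (snd e) \<le> real_vec (fst e) \<bullet> z}"
      "(sol_set ?D \<inter> {z. real_vec (fst e) \<bullet> z = real_of_int (snd e)}) facet_of sol_set ?D"
      "\<forall>j. j \<notin> range \<iota> \<longrightarrow> fst e $ j = 0"
      "Gcd (insert (snd e) (range (\<lambda>i. fst e $ \<iota> i))) = 1"
      unfolding facet_ineqs_def cylinder_sol_set[OF \<iota>] by (auto simp: case_prod_beta)
    obtain d t where d: "d \<in> ?D" "0 \<le> t" "real_vec (fst e) = t *\<^sub>R real_vec (fst d)"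
      "real_of_int (snd e) = t * real_of_int (snd d)"
      using facet_of_sol_set_proportional[OF D(1,2) D0 e(1,2)] by metis
    then obtain c where c: "c \<in> C" "d = emb_ineq \<iota> c"
      by blast
    define f where "f = ((\<chi> i. fst e $ \<iota> i), snd e)"
    have ef: "e = emb_ineq \<iota> f"
      using e(3) \<iota> by (auto simp: f_def emb_ineq_def coord_emb_def prod_eq_iff vec_eq_iff)
    have "coeff_gcd f = 1"
      using e(4) by (simp add: coeff_gcd_def f_def)
    moreover have "coeff_gcd c = 1"
      using C(4) c by blast
    moreover have fc: "real_vec (fst f) = t *\<^sub>R real_vec (fst c)"
    proof -
      have "coord_emb \<iota> (real_vec (fst f)) = t *\<^sub>R coord_emb \<iota> (real_vec (fst c))"
        using d(3) by (simp add: ef c emb_ineq_def real_vec_coord_emb)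
      then have "real_vec (fst f) $ i = (t *\<^sub>R real_vec (fst c)) $ i" for i
        using coord_emb_nth[OF \<iota>] by (metis vector_scaleR_component)
      then show ?thesis
        by (simp add: vec_eq_iff)
    qed
    moreover have sfc: "real_of_int (snd f) = t * real_of_int (snd c)"
      using d(4) by (simp add: ef c emb_ineq_def)
    moreover have "t \<noteq> 0"
    proof
      assume "t = 0"
      then have "fst f = 0" "snd f = 0"
        using fc sfc by (auto simp: real_vec_def vec_eq_iff)
      then have "coeff_gcd f = 0"
        by (auto simp: coeff_gcd_def)
      with \<open>coeff_gcd f = 1\<close> show False
        by simp
    qed
    moreover have "fst c \<noteq> 0"
      using C witnessed_nonzero c by blast
    ultimately have "f = c"
      using d(2) prim_proportional[of f c t] by simp
    then show "e \<in> ?D"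
      using ef c by blast
  qed
qed

section \<open>Diophantine approximation and boundedness of slacks\<close>

lemma Dirichlet_approx_vec:
  fixes r :: "real ^ 'n"
  assumes "0 < N"
  obtains q :: int and u where "0 < q" "q \<le> int (N ^ CARD('n))" "int_vec u"
    "\<And>i. \<bar>real_of_int q * r $ i - u $ i\<bar> < 1 / real N"
proof -
  obtain f :: "nat \<Rightarrow> 'n" where f: "bij_betw f {..<CARD('n)} UNIV"
    using ex_bij_betw_nat_finite[of "UNIV :: 'n set"] by (auto simp: atLeast0LessThan)
  obtain q p where qp: "0 < q" "q \<le> int (N ^ CARD('n))"
    "\<And>i. i < CARD('n) \<Longrightarrow> \<bar>of_int q * r $ f i - of_int (p i)\<bar> < 1 / real N"
    using Dirichlet_approx_simult[OF assms, of "CARD('n)" "\<lambda>i. r $ f i"] by metis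
  define u :: "real ^ 'n" where "u = (\<chi> j. real_of_int (p (the_inv_into {..<CARD('n)} f j)))"
  have "\<bar>real_of_int q * r $ j - u $ j\<bar> < 1 / real N" for j
  proof -
    have "the_inv_into {..<CARD('n)} f j \<in> {..<CARD('n)}"
      using f by (intro the_inv_into_into) (auto simp: bij_betw_def)
    moreover have "f (the_inv_into {..<CARD('n)} f j) = j"
      using f by (intro f_the_inv_into_f) (auto simp: bij_betw_def)
    ultimately show ?thesis
      using qp(3)[of "the_inv_into {..<CARD('n)} f j"] by (simp add: u_def)
  qed
  moreover have "int_vec u"
    by (simp add: u_def int_vec_def)
  ultimately show thesis
    using that qp by blast
qed

text \<open>An unbounded slack would, by simultaneous Diophantine approximation, yield a lattice vector
  \<open>u\<close> along which this slack increases and no slack decreases; adding \<open>u\<close> to the lattice point of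
  the facet gives an interior lattice point.\<close>

lemma slack_bounded:
  fixes C :: "((int ^ 'n) \<times> int) set"
  assumes C: "finite C" "witnessed C" "\<And>v. v \<in> strict_set C \<Longrightarrow> \<not> int_vec v" "c \<in> C"
  shows "bdd_above (slack c ` sol_set C)"
proof -
  obtain v where v: "int_vec v" "slack c v = 0" "v \<in> strict_set (C - {c})"
    using C unfolding witnessed_def by blast
  define A where "A = (\<Sum>d\<in>C. \<Sum>i\<in>UNIV. \<bar>real_of_int (fst d $ i)\<bar>)"
  have A_ge: "(\<Sum>i\<in>UNIV. \<bar>real_of_int (fst d $ i)\<bar>) \<le> A" if "d \<in> C" for d
    unfolding A_def using C(1) that by (intro member_le_sum sum_nonneg) auto
  have A0: "0 \<le> A"
    unfolding A_def by (intro sum_nonneg) auto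
  \<comment> \<open>With an error below \<open>1 / N\<close> per coordinate, no linear form of the
    system is off by more than \<open>A / N \<le> 1 / 2\<close> at the approximating lattice
    vector.\<close>
  obtain N where N: "2 * A + 1 < real N"
    using reals_Archimedean2 by blast
  then have N0: "0 < N"
    using A0 by (cases N) auto
  define B where "B = (\<Sum>d\<in>C. \<bar>slack d v\<bar>)"
  have B_ge: "slack d v \<le> B" if "d \<in> C" for d
    using member_le_sum[of d C "\<lambda>d. \<bar>slack d v\<bar>"] C(1) that by (auto simp: B_def)
  have B0: "0 \<le> B"
    unfolding B_def by (intro sum_nonneg) auto
  \<comment> \<open>Large enough that \<open>q * (B / K) < 1 / 2\<close> for every denominator
    \<open>q \<le> N ^ CARD('n)\<close> that the approximation may return.\<close>
  define K where "K = 2 * real (N ^ CARD('n)) * (B + 1)"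
  have NN: "1 \<le> real (N ^ CARD('n))"
    using N0 by simp
  have K0: "0 < K"
    using B0 N0 by (simp add: K_def)
  have "slack c x \<le> K" if x: "x \<in> sol_set C" for x
  proof (rule ccontr)
    assume big: "\<not> slack c x \<le> K"
    \<comment> \<open>Along \<open>r\<close> the slack of \<open>c\<close> grows by more than 1,
      while no slack drops by more than \<open>B / K\<close>. Multiplying by \<open>q\<close> and
      rounding costs less than 1 in total, so integrality removes the possible decrease.\<close>
    define r where "r = (1 / K) *\<^sub>R (x - v)"
    have ar: "real_vec (fst d) \<bullet> r = (slack d x - slack d v) / K" for d
      by (simp add: r_def slack_def inner_diff_right)
    obtain q u where qu: "0 < q" "q \<le> int (N ^ CARD('n))" "int_vec u"
      "\<And>i. \<bar>real_of_int q * r $ i - u $ i\<bar> < 1 / real N"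
      using Dirichlet_approx_vec[OF N0] by blast
    have approx: "\<bar>real_of_int q * (real_vec (fst d) \<bullet> r) - real_vec (fst d) \<bullet> u\<bar> \<le> 1 / 2" if "d \<in> C" for d
    proof -
      have "real_of_int q * (real_vec (fst d) \<bullet> r) - real_vec (fst d) \<bullet> u
        = (\<Sum>i\<in>UNIV. real_of_int (fst d $ i) * (real_of_int q * r $ i - u $ i))"
        by (simp add: inner_vec_def real_vec_def sum_distrib_left sum_subtractf algebra_simps)
      also have "\<bar>\<dots>\<bar> \<le> (\<Sum>i\<in>UNIV. \<bar>real_of_int (fst d $ i) * (real_of_int q * r $ i - u $ i)\<bar>)"
        by (rule sum_abs)
      also have "\<dots> \<le> (\<Sum>i\<in>UNIV. \<bar>real_of_int (fst d $ i)\<bar> * (1 / real N))"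
        using qu(4)[THEN less_imp_le] unfolding abs_mult by (intro sum_mono mult_left_mono) auto
      also have "\<dots> = (\<Sum>i\<in>UNIV. \<bar>real_of_int (fst d $ i)\<bar>) / real N"
        by (simp add: sum_divide_distrib)
      also have "\<dots> \<le> A / real N"
        using A_ge[OF that] by (simp add: divide_right_mono)
      also have "\<dots> \<le> 1 / 2"
        using N A0 N0 by (simp add: field_simps)
      finally show ?thesis .
    qed
    have q1: "1 \<le> real_of_int q"
      using qu(1) by simp
    have qN: "real_of_int q \<le> real (N ^ CARD('n))"
      using qu(2) by (metis of_int_le_iff of_int_of_nat_eq)
    have "0 \<le> real_vec (fst d) \<bullet> u" if "d \<in> C" for d
    proof -
      have "slack d x \<ge> 0"
        using x that by (simp add: sol_set_def)
      then have "- B / K \<le> real_vec (fst d) \<bullet> r"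
        unfolding ar using B_ge[OF that] K0 by (intro divide_right_mono) auto
      then have "real_of_int q * (- B / K) \<le> real_of_int q * (real_vec (fst d) \<bullet> r)"
        using q1 by (intro mult_left_mono) auto
      moreover have "real_of_int q * (B / K) < 1 / 2"
      proof -
        have "real_of_int q * B \<le> real (N ^ CARD('n)) * B"
          using qN B0 by (intro mult_right_mono)
        also have "\<dots> < real (N ^ CARD('n)) * (B + 1)"
          using NN N0 by (intro mult_strict_left_mono) auto
        finally show ?thesis
          using K0 by (simp add: K_def field_simps)
      qed
      ultimately have "- (1 / 2) < real_of_int q * (real_vec (fst d) \<bullet> r)"
        by simp
      then have "- 1 < real_vec (fst d) \<bullet> u"
        using abs_le_D1[OF approx[OF that]] by simp
      moreover have "real_vec (fst d) \<bullet> u \<in> \<int>"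
        using qu(3) by (rule Ints_inner_real_vec)
      ultimately show ?thesis
        by (auto elim!: Ints_cases)
    qed
    moreover have "0 < real_vec (fst c) \<bullet> u"
    proof -
      have "1 < real_vec (fst c) \<bullet> r"
        unfolding ar using big v(2) K0 by simp
      also have "\<dots> \<le> real_of_int q * (real_vec (fst c) \<bullet> r)"
        using q1 calculation by simp
      finally show ?thesis
        using abs_le_D1[OF approx[OF C(4)]] by simp
    qed
    ultimately have "0 < slack d (v + u)" if "d \<in> C" for d
      using v that by (cases "d = c") (auto simp: strict_set_def slack_add add_pos_nonneg)
    then have "v + u \<in> strict_set C"
      by (simp add: strict_set_def)
    moreover have "int_vec (v + u)"
      using v(1) qu(3) by (simp add: int_vec_def)
    ultimately show False
      using C(3) by blast
  qed
  then show ?thesis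
    by (intro bdd_aboveI2)
qed

text \<open>The witness of \<open>c\<close> has slack 0, so the infimum of the linear form is the
  right-hand side, and the facet width is the supremum of the slack. Boundedness of the slack allows
  the constant to be moved through the supremum.\<close>

lemma max_facet_width_cylinder:
  fixes \<iota> :: "'p::finite \<Rightarrow> 'n::finite"
  assumes \<iota>: "inj \<iota>"
    and C: "finite C" "strict_set C \<noteq> {}" "witnessed C" "\<forall>c\<in>C. coeff_gcd c = 1"
    and free: "\<And>v. v \<in> strict_set C \<Longrightarrow> \<not> int_vec v"
  shows "max_facet_width \<iota> (cylinder \<iota> (sol_set C)) = Max ((\<lambda>c. SUP x\<in>sol_set C. slack c x) ` C)"
proof -
  let ?L = "cylinder \<iota> (sol_set C)"
  let ?w = "\<lambda>(\<pi>, \<pi>0). (SUP z\<in>?L. real_vec \<pi> \<bullet> z) - (INF z\<in>?L. real_vec \<pi> \<bullet> z)"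
  have proj: "xpart \<iota> ` ?L = sol_set C"
    using surj_xpart[OF \<iota>] by (force simp: cylinder_def image_iff surj_def)
  have "?w (emb_ineq \<iota> c) = (SUP x\<in>sol_set C. slack c x)" if c: "c \<in> C" for c
  proof -
    let ?a = "real_vec (fst c)"
    let ?b = "real_of_int (snd c)"
    have "(\<lambda>z. real_vec (coord_emb \<iota> (fst c)) \<bullet> z) ` ?L = (\<lambda>x. ?a \<bullet> x) ` (xpart \<iota> ` ?L)"
      by (simp add: image_image real_vec_coord_emb inner_coord_emb[OF \<iota>])
    then have img: "(\<lambda>z. real_vec (coord_emb \<iota> (fst c)) \<bullet> z) ` ?L = (\<lambda>x. ?a \<bullet> x) ` sol_set C"
      by (simp only: proj)
    obtain v where v: "slack c v = 0" "v \<in> strict_set (C - {c})"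
      using C(3) c unfolding witnessed_def by blast
    have "0 \<le> slack d v" if "d \<in> C" for d
      using v that by (cases "d = c") (auto simp: strict_set_def intro: less_imp_le)
    then have vL: "v \<in> sol_set C"
      by (simp add: sol_set_def)
    have "(INF x\<in>sol_set C. ?a \<bullet> x) = ?b"
      using vL v(1) c by (intro cInf_eq_minimum) (auto simp: slack_def sol_set_def image_iff)
    moreover have "(SUP x\<in>sol_set C. slack c x) = (SUP x\<in>sol_set C. ?a \<bullet> x) - ?b"
    proof -
      have bdd: "bdd_above (slack c ` sol_set C)"
        using slack_bounded[OF C(1,3) free c] .
      have "(SUP x\<in>sol_set C. ?a \<bullet> x) = ?b + (SUP x\<in>sol_set C. slack c x)"
      proof (rule cSup_eq_non_empty)
        show "(\<lambda>x. ?a \<bullet> x) ` sol_set C \<noteq> {}"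
          using vL by blast
        show "y \<le> ?b + (SUP x\<in>sol_set C. slack c x)" if "y \<in> (\<lambda>x. ?a \<bullet> x) ` sol_set C" for y
          using that cSUP_upper[OF _ bdd] by (force simp: slack_def)
        show "?b + (SUP x\<in>sol_set C. slack c x) \<le> y"
          if "\<And>z. z \<in> (\<lambda>x. ?a \<bullet> x) ` sol_set C \<Longrightarrow> z \<le> y" for y
        proof -
          have "(SUP x\<in>sol_set C. slack c x) \<le> y - ?b"
            using vL that by (intro cSUP_least) (auto simp: slack_def)
          then show ?thesis
            by simp
        qed
      qed
      then show ?thesis
        by simp
    qed
    ultimately show ?thesis
      by (simp add: emb_ineq_def img)
  qed
  then show ?thesis
    unfolding max_facet_width_def facet_ineqs_cylinder[OF \<iota> C] by (simp add: image_image)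
qed

section \<open>Lattice retractions\<close>

lemma Rats_inner:
  assumes "rat_vec x" "rat_vec y"
  shows "x \<bullet> y \<in> \<rat>"
  using assms unfolding inner_vec_def rat_vec_def by (auto intro!: Rats_sum)

text \<open>\<open>M\<close> is the orthogonal projection onto the complement of
  \<open>span T\<close>, obtained by Gram-Schmidt. The vectors are never normalized, so rationality
  survives.\<close>

lemma rational_projection:
  fixes T :: "(real ^ 'n) set"
  assumes "finite T" "\<forall>t\<in>T. rat_vec t"
  shows "\<exists>M. linear M \<and> (\<forall>x. rat_vec x \<longrightarrow> rat_vec (M x)) \<and> (\<forall>x. M x = 0 \<longleftrightarrow> x \<in> span T) \<and>
             (\<forall>x y. M x \<bullet> y = x \<bullet> M y) \<and> (\<forall>x. M (M x) = M x)"
  using assms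
proof (induction T)
  case empty
  show ?case
    by (intro exI[of _ "\<lambda>x. x"]) (auto simp: linear_id[unfolded id_def])
next
  case (insert t T)
  then obtain M where M: "linear M" "\<And>x. rat_vec x \<Longrightarrow> rat_vec (M x)" "\<And>x. M x = 0 \<longleftrightarrow> x \<in> span T"
    "\<And>x y. M x \<bullet> y = x \<bullet> M y" "\<And>x. M (M x) = M x"
    by auto
  show ?case
  proof (cases "t \<in> span T")
    case True
    then have "span (insert t T) = span T"
      by (rule span_redundant)
    then show ?thesis
      using M by (intro exI[of _ M]) auto
  next
    case False
    define u where "u = M t"
    have u0: "u \<noteq> 0" and Mu: "M u = u" and ru: "rat_vec u"
      using M False insert.prems by (auto simp: u_def)
    define M' where "M' = (\<lambda>x. M x - ((u \<bullet> x) / (u \<bullet> u)) *\<^sub>R u)"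
    have uM: "u \<bullet> M x = u \<bullet> x" for x
      using M(4)[of u x] Mu by simp
    have "linear M'"
      using M(1) unfolding M'_def
      by (intro linear_compose_sub) (auto intro!: linearI simp: inner_add_right add_divide_distrib scaleR_add_left)
    moreover have "rat_vec (M' x)" if "rat_vec x" for x
    proof -
      have "u \<bullet> x \<in> \<rat>" "u \<bullet> u \<in> \<rat>"
        using that ru by (simp_all add: Rats_inner)
      then show ?thesis
        using M(2)[OF that] ru by (auto simp: M'_def rat_vec_def)
    qed
    moreover have "M' x = 0 \<longleftrightarrow> x \<in> span (insert t T)" for x
    proof
      assume "M' x = 0"
      then have "M (x - ((u \<bullet> x) / (u \<bullet> u)) *\<^sub>R t) = 0"
        using M(1) by (simp add: M'_def u_def linear_diff linear_cmul)
      then show "x \<in> span (insert t T)"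
        unfolding span_breakdown_eq M(3) by blast
    next
      assume "x \<in> span (insert t T)"
      then obtain k where "M (x - k *\<^sub>R t) = 0"
        unfolding span_breakdown_eq M(3) by blast
      then have Mx: "M x = k *\<^sub>R u"
        using M(1) by (simp add: u_def linear_diff linear_cmul)
      then have "u \<bullet> x = k * (u \<bullet> u)"
        using uM[of x] by simp
      then show "M' x = 0"
        using u0 Mx by (simp add: M'_def)
    qed
    moreover have "M' x \<bullet> y = x \<bullet> M' y" for x y
      using M(4)[of x y] by (simp add: M'_def inner_diff_left inner_diff_right inner_commute)
    moreover have "M' (M' x) = M' x" for x
    proof -
      have "M (M' x) = M' x"
        using M(1,5) Mu by (simp add: M'_def linear_diff linear_cmul)
      moreover have "u \<bullet> M' x = 0"
        using u0 by (simp add: M'_def inner_diff_right uM)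
      ultimately show ?thesis
        by (simp add: M'_def)
    qed
    ultimately show ?thesis
      by (intro exI[of _ M']) blast
  qed
qed

lemma rat_vec_int_vec: "int_vec x \<Longrightarrow> rat_vec x"
  unfolding int_vec_def rat_vec_def using Ints_subset_Rats by blast

text \<open>A finite basis replaces \<open>T\<close>. The rows of the rational projection with
  kernel \<open>span T\<close>, with denominators cleared, serve as equations.\<close>

lemma span_int_vecs_eq_kernel:
  fixes T :: "(real ^ 'n) set"
  assumes "\<And>t. t \<in> T \<Longrightarrow> int_vec t"
  obtains E :: "(int ^ 'n) set" where "finite E" "span T = {x. \<forall>e\<in>E. real_vec e \<bullet> x = 0}"
proof -
  obtain B where B: "B \<subseteq> T" "independent B" "T \<subseteq> span B"
    using maximal_independent_subset by blast
  have span: "span T = span B"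
    using B by (meson span_mono span_span subset_antisym span_minimal subspace_span)
  have "finite B" "\<forall>t\<in>B. rat_vec t"
    using B assms by (auto simp: independent_imp_finite rat_vec_int_vec)
  then obtain M where M: "linear M" "\<And>x. rat_vec x \<Longrightarrow> rat_vec (M x)" "\<And>x. M x = 0 \<longleftrightarrow> x \<in> span B"
    "\<And>x y. M x \<bullet> y = x \<bullet> M y"
    using rational_projection by metis
  have "\<exists>e. \<exists>N::int. 0 < N \<and> real_vec e = real_of_int N *\<^sub>R M (axis i 1)" for i
  proof -
    have "rat_vec (M (axis i 1))"
      by (intro M(2)) (simp add: rat_vec_def axis_def)
    then show ?thesis
      using rational_multiple_real_vec by metis
  qed
  then obtain e where e: "\<And>i. \<exists>N::int. 0 < N \<and> real_vec (e i) = real_of_int N *\<^sub>R M (axis i 1)"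
    by metis
  have "real_vec (e i) \<bullet> x = 0 \<longleftrightarrow> M x $ i = 0" for i x
  proof -
    obtain N :: int where "0 < N" "real_vec (e i) = real_of_int N *\<^sub>R M (axis i 1)"
      using e by blast
    moreover have "M (axis i 1) \<bullet> x = M x $ i"
      using M(4)[of "axis i 1" x] by (simp add: inner_axis')
    ultimately show ?thesis
      by simp
  qed
  then have "M x = 0 \<longleftrightarrow> (\<forall>d\<in>range e. real_vec d \<bullet> x = 0)" for x
    by (simp add: vec_eq_iff)
  then have "span T = {x. \<forall>d\<in>range e. real_vec d \<bullet> x = 0}"
    unfolding span using M(3) by blast
  then show thesis
    using that[of "range e"] by simp
qed

lemma Gcd_bezout:
  fixes f :: "'a \<Rightarrow> int"
  assumes "finite A"
  shows "\<exists>u. (\<Sum>i\<in>A. f i * u i) = Gcd (f ` A)"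
  using assms
proof (induction A)
  case empty
  then show ?case by simp
next
  case (insert a A)
  then obtain u where u: "(\<Sum>i\<in>A. f i * u i) = Gcd (f ` A)"
    by blast
  obtain x y where xy: "x * f a + y * Gcd (f ` A) = gcd (f a) (Gcd (f ` A))"
    using bezout_int by blast
  have "(\<Sum>i\<in>A. f i * (if i = a then x else y * u i)) = (\<Sum>i\<in>A. y * (f i * u i))"
    using insert.hyps by (intro sum.cong) auto
  also have "\<dots> = y * Gcd (f ` A)"
    by (simp add: sum_distrib_left[symmetric] u)
  finally have "(\<Sum>i\<in>insert a A. f i * (if i = a then x else y * u i)) = Gcd (f ` insert a A)"
    using insert.hyps xy by (simp add: mult.commute)
  then show ?case
    by (rule exI[of _ "\<lambda>i. if i = a then x else y * u i"])
qed

lemma int_vec_axis: "int_vec (axis i 1)"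
  by (simp add: int_vec_def axis_def)

lemma int_vec_lincomb:
  assumes "int_vec x" "int_vec y" "r \<in> \<int>"
  shows "int_vec (x + y)" "int_vec (x - y)" "int_vec (r *\<^sub>R x)"
  using assms by (auto simp: int_vec_def)

text \<open>The coefficients of the pulled back form are its values at the unit vectors, which
  \<open>\<rho>\<close> maps to lattice vectors.\<close>

lemma int_vec_adjoint:
  fixes \<rho> :: "real ^ 'n \<Rightarrow> real ^ 'm"
  assumes "linear \<rho>" "\<And>x. int_vec x \<Longrightarrow> int_vec (\<rho> x)"
  shows "int_vec (adjoint \<rho> (real_vec e))"
  unfolding int_vec_def
proof
  fix i
  have "adjoint \<rho> (real_vec e) $ i = real_vec e \<bullet> \<rho> (axis i 1)"
    using adjoint_works[OF assms(1), of "axis i 1" "real_vec e"]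
    by (simp add: inner_axis' inner_commute)
  then show "adjoint \<rho> (real_vec e) $ i \<in> \<int>"
    using Ints_inner_real_vec[OF assms(2)[OF int_vec_axis]] by simp
qed

text \<open>The lattice \<open>\<int>\<^sup>n\<close> retracts onto its intersection with a rational subspace: intersect with one
  hyperplane at a time, splitting off a lattice vector on which the normal takes the value given by
  Bezout's identity.\<close>

lemma kernel_retraction:
  fixes E :: "(int ^ 'n) set"
  assumes "finite E"
  shows "\<exists>\<rho>. linear \<rho> \<and> (\<forall>x. int_vec x \<longrightarrow> int_vec (\<rho> x)) \<and>
             (\<forall>e\<in>E. \<forall>x. real_vec e \<bullet> \<rho> x = 0) \<and> (\<forall>x. (\<forall>e\<in>E. real_vec e \<bullet> x = 0) \<longrightarrow> \<rho> x = x)"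
  using assms
proof (induction E)
  case empty
  show ?case
    by (intro exI[of _ "\<lambda>x. x"]) (auto simp: linear_id[unfolded id_def])
next
  case (insert e E)
  then obtain \<rho> where \<rho>: "linear \<rho>" "\<And>x. int_vec x \<Longrightarrow> int_vec (\<rho> x)"
    "\<And>d x. d \<in> E \<Longrightarrow> real_vec d \<bullet> \<rho> x = 0" "\<And>x. (\<forall>d\<in>E. real_vec d \<bullet> x = 0) \<Longrightarrow> \<rho> x = x"
    by auto
  obtain f where f: "adjoint \<rho> (real_vec e) = real_vec f"
    using int_vec_adjoint[OF \<rho>(1,2)] int_vec_imp_real_vec by metis
  have fx: "real_vec f \<bullet> x = real_vec e \<bullet> \<rho> x" for x
    using adjoint_works[OF \<rho>(1), of x "real_vec e"] f by (simp add: inner_commute)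
  have idem: "\<rho> (\<rho> x) = \<rho> x" for x
    using \<rho>(3,4) by blast
  show ?case
  proof (cases "f = 0")
    case True
    then have "real_vec e \<bullet> \<rho> x = 0" for x
      using fx[of x] by (simp add: real_vec_def inner_vec_def)
    then show ?thesis
      using \<rho> by (intro exI[of _ \<rho>]) auto
  next
    case False
    define g where "g = Gcd (range (($) f))"
    have "g \<noteq> 0"
      using False by (auto simp: g_def vec_eq_iff)
    define f' where "f' = (\<chi> i. f $ i div g)"
    have ff': "real_vec f = real_of_int g *\<^sub>R real_vec f'"
    proof -
      have "g dvd f $ i" for i
        unfolding g_def by (intro Gcd_dvd) auto
      then have "real_of_int (f $ i) = real_of_int g * real_of_int (f' $ i)" for i
        by (simp add: f'_def flip: of_int_mult)
      then show ?thesis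
        by (simp add: real_vec_def vec_eq_iff)
    qed
    obtain w where "(\<Sum>i\<in>UNIV. f $ i * w i) = g"
      using Gcd_bezout[of UNIV "($) f"] unfolding g_def by auto
    then have "real_vec f \<bullet> real_vec (\<chi> i. w i) = real_of_int g"
      by (simp add: inner_vec_def real_vec_def flip: of_int_mult of_int_sum)
    then obtain u where u: "int_vec u" "real_vec f \<bullet> u = real_of_int g"
      using int_vec_real_vec by blast
    \<comment> \<open>The form \<open>e\<close> takes the value \<open>g\<close> at
      \<open>\<rho> u\<close> and \<open>g * (real_vec f' \<bullet> x)\<close> at
      \<open>\<rho> x\<close>, so the difference lies in the new hyperplane. The multiple is an
      integer for lattice points \<open>x\<close>, and subtracting \<open>\<rho> u\<close> instead
      of \<open>u\<close> preserves the equations in \<open>E\<close>.\<close>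
    define \<rho>' where "\<rho>' = (\<lambda>x. \<rho> x - (real_vec f' \<bullet> x) *\<^sub>R \<rho> u)"
    have "linear \<rho>'"
      using \<rho>(1) unfolding \<rho>'_def
      by (intro linear_compose_sub) (auto intro!: linearI simp: inner_add_right scaleR_add_left)
    moreover have "int_vec (\<rho>' x)" if "int_vec x" for x
      unfolding \<rho>'_def using that u(1) \<rho>(2)
      by (intro int_vec_lincomb(2) int_vec_lincomb(3)[of _ "\<rho> u"]) (auto simp: Ints_inner_real_vec)
    moreover have "real_vec d \<bullet> \<rho>' x = 0" if "d \<in> insert e E" for d x
    proof (cases "d \<in> E")
      case True
      then show ?thesis
        using \<rho>(3) by (simp add: \<rho>'_def inner_diff_right)
    next
      case False
      with that have "d = e"
        by blast
      moreover have "real_vec e \<bullet> \<rho> x = real_of_int g * (real_vec f' \<bullet> x)"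
        using fx[of x] ff' by simp
      moreover have "real_vec e \<bullet> \<rho> u = real_of_int g"
        using fx[of u] u(2) by simp
      ultimately show ?thesis
        by (simp add: \<rho>'_def inner_diff_right)
    qed
    moreover have "\<rho>' x = x" if "\<forall>d\<in>insert e E. real_vec d \<bullet> x = 0" for x
    proof -
      have "\<rho> x = x"
        using that \<rho>(4) by blast
      moreover from this have "real_of_int g * (real_vec f' \<bullet> x) = 0"
        using fx[of x] ff' that by simp
      ultimately show ?thesis
        using \<open>g \<noteq> 0\<close> by (simp add: \<rho>'_def)
    qed
    ultimately show ?thesis
      by (intro exI[of _ \<rho>']) blast
  qed
qed

lemma affine_lattice_retraction:
  fixes T :: "(real ^ 'n) set"
  assumes "T \<noteq> {}" "\<And>t. t \<in> T \<Longrightarrow> int_vec t"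
  shows "\<exists>\<rho> t0. linear \<rho> \<and> (\<forall>x. int_vec x \<longrightarrow> int_vec (\<rho> x)) \<and> int_vec t0 \<and>
    (\<forall>x. t0 + \<rho> (x - t0) \<in> affine hull T) \<and> (\<forall>x\<in>affine hull T. t0 + \<rho> (x - t0) = x)"
proof -
  obtain t0 where t0: "t0 \<in> T"
    using assms by blast
  let ?V = "(\<lambda>x. - t0 + x) ` T"
  have V: "affine hull T = (\<lambda>x. t0 + x) ` span ?V"
  proof -
    have "?V = insert 0 ((\<lambda>x. - t0 + x) ` (T - {t0}))"
      using t0 by (force simp: image_iff)
    then have "span ?V = span ((\<lambda>x. - t0 + x) ` (T - {t0}))"
      by (simp only: span_insert_0)
    then show ?thesis
      using affine_hull_span2[OF t0] by (simp only:)
  qed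
  have iV: "int_vec v" if "v \<in> ?V" for v
    using that assms(2) t0 by (auto simp: int_vec_def)
  obtain E where E: "finite E" "span ?V = {x. \<forall>e\<in>E. real_vec e \<bullet> x = 0}"
    using span_int_vecs_eq_kernel[OF iV] by blast
  obtain \<rho> where \<rho>: "linear \<rho>" "\<And>x. int_vec x \<Longrightarrow> int_vec (\<rho> x)"
    "\<And>x. \<rho> x \<in> span ?V" "\<And>x. x \<in> span ?V \<Longrightarrow> \<rho> x = x"
    using kernel_retraction[OF E(1)] unfolding E(2) by auto
  have "t0 + \<rho> (x - t0) \<in> affine hull T" for x
    unfolding V using \<rho>(3) by blast
  moreover have "t0 + \<rho> (x - t0) = x" if "x \<in> affine hull T" for x
    using that \<rho>(4) unfolding V by auto
  ultimately show ?thesis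
    using \<rho>(1,2) assms(2)[OF t0] by blast
qed

section \<open>Primitive facet systems of full-dimensional split polyhedra\<close>

definition facet_system :: "((int ^ 'n) \<times> int) set \<Rightarrow> bool" where
  "facet_system C \<longleftrightarrow> finite C \<and> C \<noteq> {} \<and> strict_set C \<noteq> {} \<and> witnessed C \<and>
     (\<forall>c\<in>C. coeff_gcd c = 1) \<and> (\<forall>v\<in>strict_set C. \<not> int_vec v)"

definition lattice_points :: "((int ^ 'n) \<times> int) set \<Rightarrow> (real ^ 'n) set" where
  "lattice_points C = {v \<in> sol_set C. int_vec v}"

definition system_width :: "((int ^ 'n) \<times> int) set \<Rightarrow> real" where
  "system_width C = Max ((\<lambda>c. SUP x\<in>sol_set C. slack c x) ` C)"

lemma facet_system_witness:
  assumes "facet_system C" "c \<in> C"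
  obtains v where "v \<in> lattice_points C" "slack c v = 0" "v \<in> strict_set (C - {c})"
proof -
  obtain v where v: "int_vec v" "slack c v = 0" "v \<in> strict_set (C - {c})"
    using assms unfolding facet_system_def witnessed_def by blast
  have "0 \<le> slack d v" if "d \<in> C" for d
    using v that by (cases "d = c") (auto simp: strict_set_def intro: less_imp_le)
  then show thesis
    using that[of v] v by (simp add: lattice_points_def sol_set_def)
qed

lemma facet_system_bounded:
  assumes "facet_system C" "c \<in> C"
  shows "bdd_above (slack c ` sol_set C)"
  using assms by (intro slack_bounded) (auto simp: facet_system_def)

text \<open>The linear part stays integral by the adjoint, and the constant does because
  \<open>t0\<close> is a lattice point.\<close>

lemma slack_pullback:
  fixes \<rho> :: "real ^ 'n \<Rightarrow> real ^ 'n"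
  assumes "linear \<rho>" "\<And>x. int_vec x \<Longrightarrow> int_vec (\<rho> x)" "int_vec t0"
  shows "\<exists>d. \<forall>x. slack d x = slack c (t0 + \<rho> (x - t0))"
proof -
  obtain a where a: "adjoint \<rho> (real_vec (fst c)) = real_vec a"
    using int_vec_adjoint[OF assms(1,2)] int_vec_imp_real_vec by metis
  have ax: "real_vec (fst c) \<bullet> \<rho> x = real_vec a \<bullet> x" for x
    using adjoint_works[OF assms(1), of x "real_vec (fst c)"] a by (simp add: inner_commute)
  have "slack c t0 - real_vec a \<bullet> t0 \<in> \<int>"
    using assms(3) by (simp add: Ints_slack Ints_inner_real_vec)
  then obtain b where "slack c t0 - real_vec a \<bullet> t0 = real_of_int b"
    by (rule Ints_cases)
  then have "slack (a, - b) x = slack c (t0 + \<rho> (x - t0))" for x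
    by (simp add: slack_add ax inner_diff_right) (simp add: slack_def)
  then show ?thesis
    by blast
qed

text \<open>Pulling a split polyhedron back along a lattice retraction onto the affine hull of its lattice
  points does not increase its width.\<close>

lemma facet_system_retract:
  fixes C :: "((int ^ 'n) \<times> int) set"
  assumes C: "facet_system C"
    and meet: "strict_set C \<inter> affine hull lattice_points C \<noteq> {}"
  obtains D where "facet_system D" "strict_set C \<inter> affine hull lattice_points C \<subseteq> strict_set D"
    "system_width D \<le> system_width C"
    "\<And>x. \<exists>y\<in>affine hull lattice_points D. \<forall>d\<in>D. slack d x = slack d y"
proof -
  let ?T = "lattice_points C"
  have fin: "finite C" "C \<noteq> {}" "witnessed C" "\<And>v. v \<in> strict_set C \<Longrightarrow> \<not> int_vec v"
    using C by (auto simp: facet_system_def)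
  obtain x0 where x0: "x0 \<in> strict_set C" "x0 \<in> affine hull ?T"
    using meet by blast
  obtain c0 where "c0 \<in> C"
    using fin by blast
  then have ne: "?T \<noteq> {}"
    using facet_system_witness[OF C] by blast
  have lat: "int_vec v" if "v \<in> ?T" for v
    using that by (simp add: lattice_points_def)
  obtain \<rho> t0 where \<rho>: "linear \<rho>" "\<And>x. int_vec x \<Longrightarrow> int_vec (\<rho> x)" "int_vec t0"
    "\<And>x. t0 + \<rho> (x - t0) \<in> affine hull ?T" "\<And>x. x \<in> affine hull ?T \<Longrightarrow> t0 + \<rho> (x - t0) = x"
    using affine_lattice_retraction[OF ne lat] by blast
  define R where "R = (\<lambda>x. t0 + \<rho> (x - t0))"
  have R: "R x \<in> affine hull ?T" "x \<in> affine hull ?T \<Longrightarrow> R x = x" for x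
    using \<rho> by (auto simp: R_def)
  have "\<forall>c. \<exists>d. \<forall>x. slack d x = slack c (R x)"
    unfolding R_def using slack_pullback[OF \<rho>(1-3)] by blast
  then obtain f where f: "\<And>c x. slack (f c) x = slack c (R x)"
    by metis
  have RT: "R v = v" if "v \<in> ?T" for v
    using that R(2) by (simp add: hull_inc)
  have fne: "fst (f c) \<noteq> 0" if c: "c \<in> C" for c
  proof
    assume "fst (f c) = 0"
    then have "slack (f c) x = slack (f c) y" for x y
      by (simp add: slack_def real_vec_def inner_vec_def)
    moreover obtain v where v: "v \<in> ?T" "slack c v = 0"
      using facet_system_witness[OF C c] by blast
    ultimately have "slack c (R x0) = slack c (R v)"
      using f by metis
    then have "slack c x0 = 0"
      using R(2)[OF x0(2)] RT[OF v(1)] v(2) by simp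
    with x0 c show False
      by (auto simp: strict_set_def)
  qed
  \<comment> \<open>A pulled back inequality may have a common divisor. Dividing it out can only
    shrink nonnegative slacks, so it cannot increase the width.\<close>
  define h where "h = (\<lambda>c. prim (f c))"
  have g: "slack c (R x) = real_of_int (coeff_gcd (f c)) * slack (h c) x" for c x
    using slack_prim[of "f c" x] f by (simp add: h_def)
  have gpos: "1 \<le> real_of_int (coeff_gcd (f c))" if "c \<in> C" for c
    using coeff_gcd_pos[OF fne[OF that]] by simp
  have sgn: "0 < slack (h c) x \<longleftrightarrow> 0 < slack c (R x)" "0 \<le> slack (h c) x \<longleftrightarrow> 0 \<le> slack c (R x)"
    "slack (h c) x = 0 \<longleftrightarrow> slack c (R x) = 0" if "c \<in> C" for c x
    using gpos[OF that] g[of c x] by (auto simp: zero_less_mult_iff zero_le_mult_iff)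
  define D where "D = h ` C"
  have strictD: "x \<in> strict_set D \<longleftrightarrow> R x \<in> strict_set C" for x
    using sgn(1) by (auto simp: D_def strict_set_def)
  have solD: "x \<in> sol_set D \<longleftrightarrow> R x \<in> sol_set C" for x
    using sgn(2) by (auto simp: D_def sol_set_def)
  have latD: "?T \<subseteq> lattice_points D"
    using RT by (auto simp: lattice_points_def solD)
  \<comment> \<open>\<open>R\<close> fixes the lattice points of \<open>sol_set C\<close>, so the
    old witnesses still serve.\<close>
  have "witnessed D"
    unfolding witnessed_def
  proof
    fix d assume "d \<in> D"
    then obtain c where c: "c \<in> C" "d = h c"
      by (auto simp: D_def)
    obtain v where v: "v \<in> ?T" "slack c v = 0" "v \<in> strict_set (C - {c})"
      using facet_system_witness[OF C c(1)] .
    have "0 < slack (h e) v" if "e \<in> C" "h e \<noteq> h c" for e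
      using that v RT sgn(1)[OF that(1), of v] by (auto simp: strict_set_def)
    then have "v \<in> strict_set (D - {d})"
      unfolding strict_set_def D_def c(2) by blast
    moreover have "slack d v = 0"
      using sgn(3)[OF c(1), of v] v RT c by simp
    ultimately show "\<exists>v. int_vec v \<and> slack d v = 0 \<and> v \<in> strict_set (D - {d})"
      using v(1) by (auto simp: lattice_points_def)
  qed
  moreover have meetD: "strict_set C \<inter> affine hull ?T \<subseteq> strict_set D"
    using strictD R(2) by auto
  moreover have "\<not> int_vec v" if "v \<in> strict_set D" for v
  proof
    assume "int_vec v"
    then have "int_vec (R v)"
      using \<rho>(2,3) by (simp add: R_def int_vec_def)
    with that show False
      using strictD fin(4) by blast
  qed
  moreover have "finite D" "D \<noteq> {}" "\<forall>d\<in>D. coeff_gcd d = 1"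
    using fin fne by (auto simp: D_def h_def coeff_gcd_prim)
  ultimately have "facet_system D"
    unfolding facet_system_def using meet by blast
  moreover have "system_width D \<le> system_width C"
    unfolding system_width_def
  proof (rule Max.boundedI)
    show "finite ((\<lambda>d. SUP x\<in>sol_set D. slack d x) ` D)" "(\<lambda>d. SUP x\<in>sol_set D. slack d x) ` D \<noteq> {}"
      using fin by (auto simp: D_def)
    fix w assume "w \<in> (\<lambda>d. SUP x\<in>sol_set D. slack d x) ` D"
    then obtain c where c: "c \<in> C" "w = (SUP x\<in>sol_set D. slack (h c) x)"
      by (auto simp: D_def)
    have "(SUP x\<in>sol_set D. slack (h c) x) \<le> (SUP x\<in>sol_set C. slack c x)"
    proof (rule cSUP_least)
      show "sol_set D \<noteq> {}"
        using meet meetD strict_set_subset by blast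
      fix x assume x: "x \<in> sol_set D"
      then have "0 \<le> slack (h c) x"
        using c by (auto simp: D_def sol_set_def)
      then have "slack (h c) x \<le> slack c (R x)"
        unfolding g using gpos[OF c(1)] by (simp add: mult_le_cancel_right1)
      also have "\<dots> \<le> (SUP x\<in>sol_set C. slack c x)"
        using x solD facet_system_bounded[OF C c(1)] by (intro cSUP_upper) auto
      finally show "slack (h c) x \<le> (SUP x\<in>sol_set C. slack c x)" .
    qed
    also have "\<dots> \<le> Max ((\<lambda>c. SUP x\<in>sol_set C. slack c x) ` C)"
      using fin c by (intro Max_ge) auto
    finally show "w \<le> Max ((\<lambda>c. SUP x\<in>sol_set C. slack c x) ` C)"
      using c by simp
  qed
  \<comment> \<open>Every slack of \<open>D\<close> factors through \<open>R\<close>, whose values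
    lie in the affine hull of lattice points. This is what later lets the slacks at lattice points
    determine the width.\<close>
  moreover have "\<exists>y\<in>affine hull lattice_points D. \<forall>d\<in>D. slack d x = slack d y" for x
  proof (intro bexI ballI)
    show "R x \<in> affine hull lattice_points D"
      using R(1)[of x] hull_mono[OF latD] by blast
    fix d assume "d \<in> D"
    then obtain c where c: "c \<in> C" "d = h c"
      by (auto simp: D_def)
    have "slack c (R (R x)) = slack c (R x)"
      using R by simp
    then show "slack d x = slack d (R x)"
      using gpos[OF c(1)] by (simp add: g c(2))
  qed
  ultimately show thesis
    using that meetD by blast
qed

section \<open>Existence of minimal widths\<close>

definition parity_class :: "real ^ 'n \<Rightarrow> 'n set" where
  "parity_class v = {i. odd \<lfloor>v $ i\<rfloor>}"

lemma parity_class_eq_imp_midpoint: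
  assumes "int_vec v" "int_vec w" "parity_class v = parity_class w"
  shows "int_vec ((1/2) *\<^sub>R (v + w))"
  unfolding int_vec_def
proof
  fix i
  obtain a b where ab: "v $ i = real_of_int a" "w $ i = real_of_int b"
    using assms(1,2) unfolding int_vec_def by (metis Ints_cases)
  have "odd a \<longleftrightarrow> odd b"
    using assms(3) ab by (auto simp: parity_class_def set_eq_iff dest: spec[of _ i])
  then have "even (a + b)"
    by simp
  then obtain k where "a + b = 2 * k"
    by (rule evenE)
  then have "real_of_int a + real_of_int b = 2 * real_of_int k"
    by (metis of_int_add of_int_mult of_int_numeral)
  then show "((1/2) *\<^sub>R (v + w)) $ i \<in> \<int>"
    using ab by simp
qed

text \<open>Lattice points of two different facets cannot be congruent modulo 2, as their midpoint would be
  an interior lattice point.\<close>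

lemma facet_system_parity:
  fixes C :: "((int ^ 'n) \<times> int) set"
  assumes C: "facet_system C"
  obtains K :: "(int ^ 'n) \<times> int \<Rightarrow> 'n set" where "inj_on K C"
proof -
  have "\<forall>c\<in>C. \<exists>v. v \<in> lattice_points C \<and> slack c v = 0 \<and> v \<in> strict_set (C - {c})"
    using facet_system_witness[OF C] by metis
  from bchoice[OF this] obtain v where
    v: "\<And>c. c \<in> C \<Longrightarrow> v c \<in> lattice_points C \<and> slack c (v c) = 0 \<and> v c \<in> strict_set (C - {c})"
    by blast
  have "inj_on (\<lambda>c. parity_class (v c)) C"
  proof (rule inj_onI, rule ccontr)
    fix c d assume cd: "c \<in> C" "d \<in> C" "parity_class (v c) = parity_class (v d)" "c \<noteq> d"
    define m where "m = (1/2) *\<^sub>R v c + (1/2) *\<^sub>R v d"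
    have "int_vec m"
      using parity_class_eq_imp_midpoint[of "v c" "v d"] v[OF cd(1)] v[OF cd(2)] cd(3)
      by (simp add: m_def lattice_points_def scaleR_add_right)
    moreover have "0 < slack e m" if e: "e \<in> C" for e
    proof -
      have "slack e m = (slack e (v c) + slack e (v d)) / 2"
        unfolding m_def by (subst slack_affine) (simp_all add: add_divide_distrib)
      moreover have "0 \<le> slack e (v c)" "0 \<le> slack e (v d)"
        using v cd e by (auto simp: lattice_points_def sol_set_def)
      moreover have "0 < slack e (v c) \<or> 0 < slack e (v d)"
        using v[OF cd(1)] v[OF cd(2)] cd(4) e by (auto simp: strict_set_def)
      ultimately show ?thesis
        by (auto simp: add_pos_nonneg add_nonneg_pos)
    qed
    ultimately show False
      using C by (auto simp: facet_system_def strict_set_def)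
  qed
  then show thesis
    by (rule that)
qed

text \<open>Indexing by \<open>'n set\<close> gives a fixed space with as many coordinates as there
  are parity classes. Systems with different numbers of facets become comparable there; coordinates
  without a facet are set to 0.\<close>

definition slack_vector ::
    "((int ^ 'n) \<times> int \<Rightarrow> 'n set) \<Rightarrow> ((int ^ 'n) \<times> int) set \<Rightarrow> real ^ 'n \<Rightarrow> real ^ ('n set)" where
  "slack_vector K C x = (\<chi> k. if k \<in> K ` C then slack (inv_into C K k) x else 0)"

text \<open>If \<open>A\<close> consists of the slack vectors of the lattice points and their affine
  hull realizes all slack vectors, then \<open>affine hull A\<close> cut with the nonnegative
  orthant is the slack image of the whole polyhedron. The width is then a function of
  \<open>A\<close> alone.\<close>

definition width_of_slacks :: "(real ^ 'k) set \<Rightarrow> real" where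
  "width_of_slacks A = Max (range (\<lambda>k. SUP y\<in>{y \<in> affine hull A. \<forall>k. 0 \<le> y $ k}. y $ k))"

lemma slack_vector_nth:
  assumes "inj_on K C" "c \<in> C"
  shows "slack_vector K C x $ K c = slack c x"
  using assms by (simp add: slack_vector_def)

lemma slack_vector_nth_unused: "k \<notin> K ` C \<Longrightarrow> slack_vector K C x $ k = 0"
  by (simp add: slack_vector_def)

lemma affine_hull_slack_vector:
  "affine hull (slack_vector K C ` T) = slack_vector K C ` (affine hull T)"
proof -
  define M where "M = (\<lambda>x. \<chi> k. if k \<in> K ` C then real_vec (fst (inv_into C K k)) \<bullet> x else 0)"
  have lin: "linear M"
    by (intro linearI) (auto simp: M_def vec_eq_iff inner_add_right)
  have eq: "slack_vector K C = (\<lambda>x. slack_vector K C 0 + M x)"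
    by (rule ext) (simp add: slack_vector_def M_def vec_eq_iff slack_def)
  have "slack_vector K C ` S = (+) (slack_vector K C 0) ` M ` S" for S
    unfolding image_image by (subst eq) (rule refl)
  then show ?thesis
    using affine_hull_translation[of "slack_vector K C 0" "M ` T"] affine_hull_linear_image[of M T] lin
    by (simp add: linear_conv_bounded_linear)
qed

lemma system_width_eq_width_of_slacks:
  fixes C :: "((int ^ 'n) \<times> int) set"
  assumes C: "facet_system C" and K: "inj_on K C"
    and span: "\<And>x. \<exists>y\<in>affine hull lattice_points C. \<forall>c\<in>C. slack c x = slack c y"
  shows "system_width C = width_of_slacks (slack_vector K C ` lattice_points C)"
proof -
  let ?\<sigma> = "slack_vector K C"
  let ?Y = "{y \<in> affine hull (?\<sigma> ` lattice_points C). \<forall>k. 0 \<le> y $ k}"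
  have nth: "?\<sigma> x $ K c = slack c x" if "c \<in> C" for c x
    using slack_vector_nth[OF K that] .
  have fin: "finite C" "C \<noteq> {}"
    using C by (auto simp: facet_system_def)
  have ne: "sol_set C \<noteq> {}"
    using C strict_set_subset by (fastforce simp: facet_system_def)
  have nonneg: "(\<forall>k. 0 \<le> ?\<sigma> x $ k) \<longleftrightarrow> x \<in> sol_set C" for x
  proof
    assume "\<forall>k. 0 \<le> ?\<sigma> x $ k"
    then have "0 \<le> slack c x" if "c \<in> C" for c
      by (simp flip: nth[OF that])
    then show "x \<in> sol_set C"
      by (simp add: sol_set_def)
  next
    assume x: "x \<in> sol_set C"
    show "\<forall>k. 0 \<le> ?\<sigma> x $ k"
    proof
      fix k show "0 \<le> ?\<sigma> x $ k"
        using x nth slack_vector_nth_unused[of k K C x] by (cases "k \<in> K ` C") (auto simp: sol_set_def)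
    qed
  qed
  have Y: "?Y = ?\<sigma> ` sol_set C"
  proof (intro equalityI subsetI)
    fix y assume "y \<in> ?Y"
    then show "y \<in> ?\<sigma> ` sol_set C"
      unfolding affine_hull_slack_vector using nonneg by auto
  next
    fix y assume "y \<in> ?\<sigma> ` sol_set C"
    then obtain x where x: "x \<in> sol_set C" "y = ?\<sigma> x"
      by blast
    obtain z where z: "z \<in> affine hull lattice_points C" "\<forall>c\<in>C. slack c x = slack c z"
      using span by blast
    have "?\<sigma> x = ?\<sigma> z"
      using z(2) by (auto simp: slack_vector_def vec_eq_iff inv_into_into)
    then show "y \<in> ?Y"
      unfolding affine_hull_slack_vector using z(1) x nonneg[of x] by auto
  qed
  define g where "g = (\<lambda>k. SUP y\<in>?Y. y $ k)"
  have used: "g (K c) = (SUP x\<in>sol_set C. slack c x)" if "c \<in> C" for c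
    unfolding g_def Y image_image using nth[OF that] by simp
  \<comment> \<open>Coordinates without a facet contribute 0, which is harmless because every
    supremum of a slack is nonnegative.\<close>
  have unused: "g k = 0" if "k \<notin> K ` C" for k
    unfolding g_def Y image_image using slack_vector_nth_unused[OF that] ne by simp
  have sup_nonneg: "0 \<le> (SUP x\<in>sol_set C. slack c x)" if "c \<in> C" for c
  proof -
    obtain x where x: "x \<in> sol_set C"
      using ne by blast
    then have "0 \<le> slack c x"
      using that by (simp add: sol_set_def)
    also have "\<dots> \<le> (SUP x\<in>sol_set C. slack c x)"
      using facet_system_bounded[OF C that] x by (intro cSUP_upper)
    finally show ?thesis .
  qed
  show ?thesis
    unfolding system_width_def width_of_slacks_def g_def[symmetric]
  proof (rule antisym)
    show "Max ((\<lambda>c. SUP x\<in>sol_set C. slack c x) ` C) \<le> Max (range g)"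
    proof (rule Max_mono)
      show "(\<lambda>c. SUP x\<in>sol_set C. slack c x) ` C \<subseteq> range g"
        by (auto simp flip: used)
      show "(\<lambda>c. SUP x\<in>sol_set C. slack c x) ` C \<noteq> {}"
        using fin(2) by blast
    qed simp
    show "Max (range g) \<le> Max ((\<lambda>c. SUP x\<in>sol_set C. slack c x) ` C)"
    proof (rule Max.boundedI)
      fix w assume "w \<in> range g"
      then obtain k where k: "w = g k"
        by blast
      have "\<exists>c\<in>C. w \<le> (SUP x\<in>sol_set C. slack c x)"
      proof (cases "k \<in> K ` C")
        case True
        then show ?thesis
          using used k by auto
      next
        case False
        then show ?thesis
          using unused k sup_nonneg fin(2) by auto
      qed
      then show "w \<le> Max ((\<lambda>c. SUP x\<in>sol_set C. slack c x) ` C)"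
        using fin(1) by (meson Max_ge finite_imageI imageI order_trans)
    qed auto
  qed
qed

lemma finite_vec_coordinates:
  fixes B :: "real set"
  assumes "finite B"
  shows "finite {y :: real ^ 'k. \<forall>k. y $ k \<in> B}"
proof -
  have "finite {f :: 'k \<Rightarrow> real. \<forall>k. f k \<in> B}"
    using finite_set_of_finite_funs[OF finite[of "UNIV :: 'k set"] assms] by simp
  moreover have "{y :: real ^ 'k. \<forall>k. y $ k \<in> B} \<subseteq> vec_lambda ` {f. \<forall>k. f k \<in> B}"
    by (auto intro!: image_eqI[of _ _ "($) y" for y])
  ultimately show ?thesis
    by (rule finite_surj)
qed

text \<open>There may be infinitely many such systems, but the slack vectors of their lattice points
  form subsets of one finite grid, and the subset determines the width.\<close>

lemma finite_spanned_widths: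
  "finite {system_width C | C :: ((int ^ 'n) \<times> int) set. facet_system C \<and> system_width C \<le> W \<and>
     (\<forall>x. \<exists>y\<in>affine hull lattice_points C. \<forall>c\<in>C. slack c x = slack c y)}"
proof -
  let ?B = "real_of_int ` {0..\<lfloor>W\<rfloor>} \<union> {0}"
  let ?G = "{y :: real ^ ('n set). \<forall>k. y $ k \<in> ?B}"
  have "finite (width_of_slacks ` Pow ?G)"
    using finite_vec_coordinates[of ?B] by blast
  moreover have "system_width C \<in> width_of_slacks ` Pow ?G"
    if C: "facet_system C" "system_width C \<le> W"
      "\<forall>x. \<exists>y\<in>affine hull lattice_points C. \<forall>c\<in>C. slack c x = slack c y" for C :: "((int ^ 'n) \<times> int) set"
  proof -
    obtain K :: "(int ^ 'n) \<times> int \<Rightarrow> 'n set" where K: "inj_on K C"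
      using facet_system_parity[OF C(1)] .
    have "slack c v \<in> ?B" if "c \<in> C" "v \<in> lattice_points C" for c v
    proof -
      have v: "v \<in> sol_set C" "int_vec v"
        using that by (auto simp: lattice_points_def)
      have "slack c v \<le> (SUP x\<in>sol_set C. slack c x)"
        using facet_system_bounded[OF C(1) that(1)] v(1) by (intro cSUP_upper)
      also have "\<dots> \<le> system_width C"
        unfolding system_width_def using C(1) that(1) by (intro Max_ge) (auto simp: facet_system_def)
      finally have "slack c v \<le> W"
        using C(2) by simp
      moreover obtain k where "slack c v = real_of_int k"
        using Ints_slack[OF v(2)] by (rule Ints_cases)
      moreover have "0 \<le> slack c v"
        using v(1) that(1) by (simp add: sol_set_def)
      ultimately show ?thesis
        by (auto simp: le_floor_iff)
    qed
    then have "slack_vector K C v $ k \<in> ?B" if "v \<in> lattice_points C" for v k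
      using that slack_vector_nth[OF K] slack_vector_nth_unused[of k K C v]
      by (cases "k \<in> K ` C") (force, simp)
    then have "slack_vector K C ` lattice_points C \<in> Pow ?G"
      by blast
    then show ?thesis
      using system_width_eq_width_of_slacks[OF C(1) K] C(3) by blast
  qed
  ultimately show ?thesis
    by (elim rev_finite_subset) (intro subsetI, elim CollectE exE conjE, simp only:)
qed

section \<open>Minimal widths over a face\<close>

lemma facet_system_imp_split_polyhedron:
  "facet_system C \<Longrightarrow> split_polyhedron (sol_set C)"
  by (intro witnessed_imp_split_polyhedron) (auto simp: facet_system_def)

lemma interior_facet_system:
  "facet_system C \<Longrightarrow> interior (sol_set C) = strict_set C"
  by (intro interior_sol_set) (auto simp: facet_system_def)

lemma split_polyhedron_imp_facet_system:
  assumes "split_polyhedron L" "interior L \<noteq> {}"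
  obtains C where "facet_system C" "L = sol_set C"
  using split_polyhedron_imp_witnessed[OF assms] assms(2) unfolding facet_system_def by metis

lemma max_facet_width_facet_system:
  "inj \<iota> \<Longrightarrow> facet_system C \<Longrightarrow> max_facet_width \<iota> (cylinder \<iota> (sol_set C)) = system_width C"
  unfolding system_width_def by (intro max_facet_width_cylinder) (auto simp: facet_system_def)

text \<open>A body whose interior contains the nonempty \<open>rel_interior F\<close> is
  full-dimensional and hence given by a facet system.\<close>

lemma face_widths_eq:
  fixes \<iota> :: "'p::finite \<Rightarrow> 'n::finite"
  assumes "inj \<iota>" "rel_interior F \<noteq> {}"
  shows "face_widths \<iota> F = {system_width C | C. facet_system C \<and> rel_interior F \<subseteq> strict_set C}"
proof (intro equalityI subsetI)
  fix w assume "w \<in> face_widths \<iota> F"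
  then obtain L where L: "split_polyhedron L" "rel_interior F \<subseteq> interior L"
    "w = max_facet_width \<iota> (cylinder \<iota> L)"
    unfolding face_widths_def by blast
  then obtain C where "facet_system C" "L = sol_set C"
    using assms(2) split_polyhedron_imp_facet_system by (metis subset_empty)
  then show "w \<in> {system_width C | C. facet_system C \<and> rel_interior F \<subseteq> strict_set C}"
    using L max_facet_width_facet_system[OF assms(1)] interior_facet_system by (intro CollectI exI conjI) auto
next
  fix w assume "w \<in> {system_width C | C. facet_system C \<and> rel_interior F \<subseteq> strict_set C}"
  then obtain C where C: "facet_system C" "rel_interior F \<subseteq> strict_set C" "w = system_width C"
    by blast
  then show "w \<in> face_widths \<iota> F"
    unfolding face_widths_def
    using facet_system_imp_split_polyhedron[OF C(1)] interior_facet_system[OF C(1)]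
      max_facet_width_facet_system[OF assms(1) C(1)]
    by (intro CollectI exI[of _ "sol_set C"]) simp
qed

text \<open>A closed body around \<open>rel_interior F\<close> contains the lattice points of
  \<open>F\<close>, which span \<open>F\<close>; the retracted body therefore still surrounds
  \<open>rel_interior F\<close>. So every width up to a known one, \<open>w0\<close>, is bounded
  below by an element of the finite set \<open>V\<close> of admissible widths.\<close>

lemma has_minimum_face_widths:
  fixes \<iota> :: "'p::finite \<Rightarrow> 'n::finite"
  assumes \<iota>: "inj \<iota>" and F: "convex F" "F \<noteq> {}" "F = convex hull {x \<in> F. int_vec x}"
    and ne: "face_widths \<iota> F \<noteq> {}"
  shows "has_minimum (face_widths \<iota> F)"
proof -
  have ri: "rel_interior F \<noteq> {}"
    using F(1,2) rel_interior_eq_empty by blast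
  note eq = face_widths_eq[OF \<iota> ri]
  let ?spanned = "\<lambda>C. \<forall>x. \<exists>y\<in>affine hull lattice_points C. \<forall>c\<in>C. slack c x = slack c y"
  obtain w0 where w0: "w0 \<in> face_widths \<iota> F"
    using ne by blast
  define V where "V = {system_width C | C. facet_system C \<and> rel_interior F \<subseteq> strict_set C \<and>
    system_width C \<le> w0 \<and> ?spanned C}"
  have "finite V"
    unfolding V_def by (rule finite_subset[OF _ finite_spanned_widths[of w0]]) blast
  have red: "\<exists>v\<in>V. v \<le> w" if "w \<in> face_widths \<iota> F" "w \<le> w0" for w
  proof -
    obtain C where C: "facet_system C" "rel_interior F \<subseteq> strict_set C" "w = system_width C"
      using \<open>w \<in> face_widths \<iota> F\<close> eq by blast
    have "F \<subseteq> closure (rel_interior F)"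
      using convex_closure_rel_interior[OF F(1)] closure_subset by blast
    also have "\<dots> \<subseteq> sol_set C"
      using C(2) strict_set_subset closed_sol_set by (intro closure_minimal) blast+
    finally have "{x \<in> F. int_vec x} \<subseteq> lattice_points C"
      by (auto simp: lattice_points_def)
    then have "convex hull {x \<in> F. int_vec x} \<subseteq> affine hull lattice_points C"
      using convex_hull_subset_affine_hull[of "{x \<in> F. int_vec x}"] hull_mono[of _ _ affine] by blast
    then have "F \<subseteq> affine hull lattice_points C"
      using F(3) by blast
    then have sub: "rel_interior F \<subseteq> strict_set C \<inter> affine hull lattice_points C"
      using C(2) rel_interior_subset by blast
    with ri have "strict_set C \<inter> affine hull lattice_points C \<noteq> {}"
      by blast
    then obtain D where D: "facet_system D" "strict_set C \<inter> affine hull lattice_points C \<subseteq> strict_set D"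
      "system_width D \<le> system_width C" "?spanned D"
      using facet_system_retract[OF C(1)] by metis
    have "rel_interior F \<subseteq> strict_set D"
      using sub D(2) by blast
    moreover have "system_width D \<le> w0"
      using D(3) C(3) \<open>w \<le> w0\<close> by simp
    ultimately have "system_width D \<in> V"
      unfolding V_def using D(1,4) by blast
    then show ?thesis
      using D(3) C(3) by blast
  qed
  have "V \<noteq> {}"
    using red[OF w0] by blast
  moreover have "V \<subseteq> face_widths \<iota> F"
    unfolding V_def eq by blast
  ultimately have "Min V \<in> face_widths \<iota> F"
    using \<open>finite V\<close> Min_in by blast
  moreover have "Min V \<le> w" if "w \<in> face_widths \<iota> F" for w
  proof (cases "w \<le> w0")
    case True
    then show ?thesis
      using red[OF that] \<open>finite V\<close> by (meson Min_le order_trans)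
  next
    case False
    then show ?thesis
      using red[OF w0] \<open>finite V\<close> by (meson Min_le order_trans linear)
  qed
  ultimately show ?thesis
    unfolding has_minimum_def by blast
qed

section \<open>Violated faces and split proofs\<close>

text \<open>A segment of \<open>S\<close> with an inner point in \<open>F\<close> has both ends in
  \<open>F\<close>. Hence the points of \<open>S\<close> for which the claim holds form a convex
  set, and this set contains \<open>Z\<close>.\<close>

lemma face_of_integral_hull:
  assumes "F face_of S" "S = convex hull Z"
  shows "F = convex hull (Z \<inter> F)"
proof
  show "convex hull (Z \<inter> F) \<subseteq> F"
    using face_of_imp_convex[OF assms(1)] by (intro hull_minimal) auto
  let ?Y = "{x \<in> S. x \<in> F \<longrightarrow> x \<in> convex hull (Z \<inter> F)}"
  have "convex ?Y"
  proof (rule convexI)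
    fix x y and u v :: real
    assume xy: "x \<in> ?Y" "y \<in> ?Y" and uv: "0 \<le> u" "0 \<le> v" "u + v = 1"
    let ?w = "u *\<^sub>R x + v *\<^sub>R y"
    have "?w \<in> S"
      using xy uv unfolding assms(2) by (auto intro: convexD[OF convex_convex_hull])
    moreover have "?w \<in> convex hull (Z \<inter> F)" if w: "?w \<in> F"
    proof (cases "x = y \<or> u = 0 \<or> v = 0")
      case True
      then have "?w = x \<or> ?w = y"
        using uv by (auto simp: scaleR_add_left[symmetric])
      then show ?thesis
        using xy w by auto
    next
      case False
      have "?w \<in> open_segment x y"
        unfolding in_segment using False uv eq_diff_eq[of u 1 v] by (intro conjI exI[of _ v]) auto
      then have "x \<in> F" "y \<in> F"
        using assms(1) xy w unfolding face_of_def by blast+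
      then show ?thesis
        using xy uv by (auto intro: convexD[OF convex_convex_hull])
    qed
    ultimately show "?w \<in> ?Y"
      by blast
  qed
  moreover have "Z \<subseteq> ?Y"
    using assms(2) by (auto intro: hull_inc)
  ultimately have "S \<subseteq> ?Y"
    unfolding assms(2) by (intro hull_minimal)
  then show "F \<subseteq> convex hull (Z \<inter> F)"
    using face_of_imp_subset[OF assms(1)] by blast
qed

text \<open>Equations that hold on the face are thickened to slabs of width 2; since slacks are integral,
  this creates no new interior lattice points.\<close>

lemma face_in_split_polyhedron:
  fixes C :: "((int ^ 'n) \<times> int) set"
  assumes C: "finite C" and F: "F face_of sol_set C" "F \<noteq> {}"
    and free: "\<And>v. v \<in> rel_interior F \<Longrightarrow> \<not> int_vec v"
  obtains L where "split_polyhedron L" "rel_interior F \<subseteq> interior L"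
proof -
  have conv: "convex F" and FC: "F \<subseteq> sol_set C"
    using F face_of_imp_convex face_of_imp_subset by blast+
  \<comment> \<open>\<open>J\<close> collects the constraints that are equations on
    \<open>F\<close>; the remaining ones turn out to be strict on
    \<open>rel_interior F\<close>.\<close>
  define J where "J = {c \<in> C. \<forall>x\<in>F. slack c x = 0}"
  define I where "I = C - J"
  have I_pos: "0 < slack c x" if c: "c \<in> I" and x: "x \<in> rel_interior F" for c x
  proof -
    obtain y where y: "y \<in> F" "slack c y \<noteq> 0"
      using c by (auto simp: I_def J_def)
    then have ypos: "0 < slack c y"
      using FC c by (force simp: I_def sol_set_def)
    obtain e where e: "e > 0" "x + e *\<^sub>R (x - y) \<in> F"
      using rel_interior_extend[OF conv x y(1)] by blast
    have "0 \<le> slack c (x + e *\<^sub>R (x - y))"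
      using e(2) FC c by (auto simp: I_def sol_set_def)
    then have "e * slack c y \<le> (1 + e) * slack c x"
      by (simp add: slack_extend)
    moreover have "0 < e * slack c y"
      using e ypos by simp
    ultimately have "0 < (1 + e) * slack c x"
      by linarith
    then show ?thesis
      using e(1) by (simp add: zero_less_mult_iff)
  qed
  obtain x0 where x0: "x0 \<in> rel_interior F"
    using conv F(2) rel_interior_eq_empty by blast
  then have x0F: "x0 \<in> F" and x0I: "x0 \<in> strict_set I"
    using rel_interior_subset I_pos by (auto simp: strict_set_def)
  have openI: "open (strict_set I)"
    using C by (intro open_strict_set) (auto simp: I_def)
  have in_C: "w \<in> sol_set C" if "w \<in> strict_set I" "\<forall>c\<in>J. slack c w = 0" for w
  proof -
    have "0 \<le> slack c w" if "c \<in> C" for c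
      using that \<open>w \<in> strict_set I\<close> \<open>\<forall>c\<in>J. slack c w = 0\<close>
      by (cases "c \<in> J") (auto simp: I_def strict_set_def intro: less_imp_le)
    then show ?thesis
      by (simp add: sol_set_def)
  qed
  \<comment> \<open>The equations in \<open>J\<close> together with strictness for \<open>I\<close>
    force membership in \<open>F\<close>: the segment from \<open>w\<close> through
    \<open>x0\<close> can be prolonged inside \<open>sol_set C\<close>, and the face property at
    \<open>x0\<close> pulls \<open>w\<close> into \<open>F\<close>.\<close>
  have in_F: "w \<in> F" if w: "w \<in> strict_set I" "\<forall>c\<in>J. slack c w = 0" for w
  proof (cases "w = x0")
    case True
    then show ?thesis
      using x0F by simp
  next
    case False
    obtain e where e: "e > 0" "x0 + e *\<^sub>R (x0 - w) \<in> strict_set I"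
      using open_extend[OF openI x0I] by blast
    let ?y = "x0 + e *\<^sub>R (x0 - w)"
    have "\<forall>c\<in>J. slack c ?y = 0"
      using w(2) x0F by (auto simp: slack_extend J_def)
    then have "?y \<in> sol_set C"
      using in_C e(2) by blast
    moreover have "x0 \<in> open_segment w ?y"
    proof -
      have "x0 = (1 - 1 / (1 + e)) *\<^sub>R w + (1 / (1 + e)) *\<^sub>R ?y"
      proof -
        have "(1 + e) *\<^sub>R ((1 - 1 / (1 + e)) *\<^sub>R w + (1 / (1 + e)) *\<^sub>R ?y) = e *\<^sub>R w + ?y"
          using e(1) by (simp add: scaleR_add_right right_diff_distrib)
        also have "\<dots> = (1 + e) *\<^sub>R x0"
          by (simp add: algebra_simps)
        finally show ?thesis
          using e(1) by (simp add: add_eq_0_iff)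
      qed
      moreover have "w \<noteq> ?y"
      proof
        assume "w = ?y"
        then have "(1 + e) *\<^sub>R (x0 - w) = 0"
          by (simp add: algebra_simps)
        with False e(1) show False
          by simp
      qed
      ultimately show ?thesis
        unfolding in_segment using e(1) by (intro conjI exI[of _ "1 / (1 + e)"]) auto
    qed
    ultimately show ?thesis
      using F(1) in_C[OF w] x0F unfolding face_of_def by blast
  qed
  define K where "K = I \<union> (\<lambda>c. (fst c, snd c - 1)) ` J \<union> (\<lambda>c. (- fst c, - snd c - 1)) ` J"
  have slacks: "slack (fst c, snd c - 1) x = slack c x + 1" "slack (- fst c, - snd c - 1) x = 1 - slack c x"
    for c :: "(int ^ 'n) \<times> int" and x
  proof -
    have "real_vec (- fst c) = - real_vec (fst c)"
      by (simp add: real_vec_def vec_eq_iff)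
    then show "slack (fst c, snd c - 1) x = slack c x + 1" "slack (- fst c, - snd c - 1) x = 1 - slack c x"
      by (simp_all add: slack_def)
  qed
  have K: "x \<in> strict_set K \<longleftrightarrow> x \<in> strict_set I \<and> (\<forall>c\<in>J. -1 < slack c x \<and> slack c x < 1)" for x
    unfolding K_def strict_set_def mem_Collect_eq ball_Un ball_simps slacks by force
  have sub: "rel_interior F \<subseteq> strict_set K"
  proof
    fix x assume x: "x \<in> rel_interior F"
    then have "x \<in> F"
      using rel_interior_subset by blast
    with x I_pos show "x \<in> strict_set K"
      unfolding K by (auto simp: strict_set_def J_def)
  qed
  have "\<not> int_vec v" if v: "v \<in> strict_set K" for v
  proof
    assume iv: "int_vec v"
    have v0: "\<forall>c\<in>J. slack c v = 0"
    proof
      fix c assume "c \<in> J"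
      then have "-1 < slack c v" "slack c v < 1"
        using v K by blast+
      then show "slack c v = 0"
        using Ints_slack[OF iv, of c] by (auto elim!: Ints_cases)
    qed
    have vI: "v \<in> strict_set I"
      using v K by blast
    \<comment> \<open>\<open>strict_set I\<close> is an open neighbourhood of \<open>v\<close> whose
      trace on the affine hull stays in \<open>F\<close>; this makes \<open>v\<close> relatively
      interior.\<close>
    have "strict_set I \<inter> affine hull F \<subseteq> F"
    proof
      fix w assume w: "w \<in> strict_set I \<inter> affine hull F"
      have "slack c w = 0" if "c \<in> J" for c
      proof -
        have "affine hull F \<subseteq> {x. real_vec (fst c) \<bullet> x = real_of_int (snd c)}"
          using that by (intro hull_minimal affine_hyperplane) (auto simp: J_def slack_def)
        with w show ?thesis
          by (auto simp: slack_def)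
      qed
      with w in_F show "w \<in> F"
        by blast
    qed
    then have "v \<in> rel_interior F"
      unfolding mem_rel_interior using openI vI in_F[OF vI v0] by blast
    with free iv show False
      by blast
  qed
  moreover have "finite K"
    using C by (auto simp: K_def I_def J_def)
  moreover have "strict_set K \<noteq> {}"
    using x0 sub by blast
  ultimately obtain L where "split_polyhedron L" "strict_set K \<subseteq> interior L"
    using extend_to_split_polyhedron[of K] by metis
  then show thesis
    using that sub by blast
qed

text \<open>One inclusion holds because the projection is open, the other because it is
  continuous.\<close>

lemma interior_cylinder:
  fixes \<iota> :: "'p::finite \<Rightarrow> 'n::finite"
  assumes "inj \<iota>"
  shows "interior (cylinder \<iota> S) = cylinder \<iota> (interior S)"
proof
  have "open (xpart \<iota> ` interior (cylinder \<iota> S))"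
    using linear_xpart surj_xpart[OF assms] by (intro open_surjective_linear_image) auto
  moreover have "xpart \<iota> ` interior (cylinder \<iota> S) \<subseteq> S"
    using interior_subset by (fastforce simp: cylinder_def)
  ultimately have "xpart \<iota> ` interior (cylinder \<iota> S) \<subseteq> interior S"
    by (rule interior_maximal[rotated])
  then show "interior (cylinder \<iota> S) \<subseteq> cylinder \<iota> (interior S)"
    by (auto simp: cylinder_def)
next
  have "continuous_on UNIV (xpart \<iota>)"
    by (intro linear_continuous_on linear_conv_bounded_linear[THEN iffD1] linear_xpart)
  then have "open (cylinder \<iota> (interior S))"
    unfolding cylinder_def using continuous_open_vimage[of "interior S" "xpart \<iota>"]
    by (simp add: vimage_def continuous_on_eq_continuous_at)
  moreover have "cylinder \<iota> (interior S) \<subseteq> cylinder \<iota> S"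
    using interior_subset by (fastforce simp: cylinder_def)
  ultimately show "cylinder \<iota> (interior S) \<subseteq> interior (cylinder \<iota> S)"
    by (rule interior_maximal[rotated])
qed

section \<open>Rounds of relaxation\<close>

lemma iterated_Cl_Suc: "iterated_Cl (Suc k) \<S> P = Cl \<S> (iterated_Cl k \<S> P)"
  by (simp add: iterated_Cl_def)

lemma iterated_Cl_0: "iterated_Cl 0 \<S> P = P"
  by (simp add: iterated_Cl_def)

lemma convex_iterated_Cl:
  assumes "convex P"
  shows "convex (iterated_Cl k \<S> P)"
  using assms
  by (cases k) (auto simp: iterated_Cl_0 iterated_Cl_Suc Cl_def relax_def intro: convex_INT)

text \<open>Nonemptiness of the family matters: the closure over the empty family is the whole
  space.\<close>

lemma iterated_Cl_subset:
  assumes "convex P" "\<S> \<noteq> {}"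
  shows "iterated_Cl k \<S> P \<subseteq> P"
proof (induction k)
  case (Suc k)
  obtain L where L: "L \<in> \<S>"
    using assms by blast
  have "relax L (iterated_Cl k \<S> P) \<subseteq> iterated_Cl k \<S> P"
    unfolding relax_def using convex_iterated_Cl[OF assms(1)] by (intro hull_minimal) auto
  with L Suc show ?case
    unfolding iterated_Cl_Suc Cl_def by blast
qed (simp add: iterated_Cl_0)

text \<open>Convexity of this set is what transfers a round: if the points of \<open>Q\<close>
  outside a split body avoid the violated points over \<open>F\<close>, then so does their convex
  hull.\<close>

lemma convex_below_level:
  fixes \<delta> :: "real ^ 'n"
  assumes Q: "convex Q" and proj: "\<And>z. z \<in> Q \<Longrightarrow> \<delta> \<bullet> z \<le> \<delta>0 \<Longrightarrow> xpart \<iota> z \<in> S"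
    and F: "F face_of S"
  shows "convex {z \<in> Q. \<not> (\<delta> \<bullet> z < \<delta>0 \<and> xpart \<iota> z \<in> F)}"
proof (rule convexI)
  let ?Y = "{z \<in> Q. \<not> (\<delta> \<bullet> z < \<delta>0 \<and> xpart \<iota> z \<in> F)}"
  note lin = linear_add[OF linear_xpart] linear_cmul[OF linear_xpart]
  text \<open>A convex combination below the level has an endpoint \<open>a\<close> below the level. If the other endpoint
    \<open>b\<close> is above it, the segment is cut at the level; the projected segment then lies in \<open>S\<close>, and its
    endpoint lies in the face.\<close>
  have aux: False
    if ab: "a \<in> ?Y" "b \<in> Q" and t: "0 \<le> t" "t < 1" and w: "w = (1 - t) *\<^sub>R a + t *\<^sub>R b"
      "\<delta> \<bullet> w < \<delta>0" "xpart \<iota> w \<in> F" and a: "\<delta> \<bullet> a < \<delta>0" for a b w t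
  proof -
    have "\<exists>c s. c \<in> Q \<and> \<delta> \<bullet> c \<le> \<delta>0 \<and> 0 \<le> s \<and> s < 1 \<and> w = (1 - s) *\<^sub>R a + s *\<^sub>R c"
    proof (cases "\<delta> \<bullet> b \<le> \<delta>0")
      case True
      then show ?thesis
        using ab t w by blast
    next
      case False
      define r where "r = (\<delta>0 - \<delta> \<bullet> a) / (\<delta> \<bullet> b - \<delta> \<bullet> a)"
      have r: "0 < r" "r < 1"
        using False a by (auto simp: r_def)
      define c where "c = (1 - r) *\<^sub>R a + r *\<^sub>R b"
      have "c \<in> Q"
        using ab r Q unfolding c_def by (intro convexD) auto
      moreover have "\<delta> \<bullet> c = \<delta>0"
      proof -
        have "\<delta> \<bullet> c = \<delta> \<bullet> a + r * (\<delta> \<bullet> b - \<delta> \<bullet> a)"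
          by (simp add: c_def inner_add_right algebra_simps)
        then show ?thesis
          using False a by (simp add: r_def)
      qed
      moreover have "t < r"
      proof -
        have "\<delta> \<bullet> w = \<delta> \<bullet> a + t * (\<delta> \<bullet> b - \<delta> \<bullet> a)"
          by (simp add: w inner_add_right algebra_simps)
        then have "t * (\<delta> \<bullet> b - \<delta> \<bullet> a) < \<delta>0 - \<delta> \<bullet> a"
          using w(2) by simp
        then show ?thesis
          using False a by (simp add: r_def pos_less_divide_eq)
      qed
      moreover have "w = (1 - t / r) *\<^sub>R a + (t / r) *\<^sub>R c"
      proof -
        have "(1 - t / r) + (t / r) * (1 - r) = 1 - t" "(t / r) * r = t"
          using r by (auto simp: field_simps)
        then show ?thesis
          unfolding c_def w(1) by (simp add: scaleR_add_right flip: scaleR_add_left add.assoc)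
      qed
      ultimately show ?thesis
        using t r by (intro exI[of _ c] exI[of _ "t / r"]) auto
    qed
    then obtain c s where c: "c \<in> Q" "\<delta> \<bullet> c \<le> \<delta>0" "0 \<le> s" "s < 1" "w = (1 - s) *\<^sub>R a + s *\<^sub>R c"
      by blast
    have xw: "xpart \<iota> w = (1 - s) *\<^sub>R xpart \<iota> a + s *\<^sub>R xpart \<iota> c"
      unfolding c(5) by (simp add: lin)
    have "xpart \<iota> a \<in> F"
    proof (cases "s = 0 \<or> xpart \<iota> a = xpart \<iota> c")
      case True
      then have "xpart \<iota> w = xpart \<iota> a"
        unfolding xw by (auto simp flip: scaleR_add_left)
      with w show ?thesis
        by simp
    next
      case False
      then have "xpart \<iota> w \<in> open_segment (xpart \<iota> a) (xpart \<iota> c)"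
        unfolding in_segment using xw c by (intro conjI exI[of _ s]) auto
      moreover have "xpart \<iota> a \<in> S" "xpart \<iota> c \<in> S"
        using proj ab a c by auto
      ultimately show ?thesis
        using F w(3) unfolding face_of_def by blast
    qed
    with ab a show False
      by blast
  qed
  fix x y and u v :: real
  assume xy: "x \<in> ?Y" "y \<in> ?Y" and uv: "0 \<le> u" "0 \<le> v" "u + v = 1"
  let ?w = "u *\<^sub>R x + v *\<^sub>R y"
  have "?w \<in> Q"
    using xy uv Q by (intro convexD) auto
  moreover have "\<not> (\<delta> \<bullet> ?w < \<delta>0 \<and> xpart \<iota> ?w \<in> F)"
  proof
    assume w: "\<delta> \<bullet> ?w < \<delta>0 \<and> xpart \<iota> ?w \<in> F"
    then have "u \<noteq> 0" "v \<noteq> 0"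
      using xy uv by auto
    then have uv': "u < 1" "v < 1" "u = 1 - v" "v = 1 - u"
      using uv by auto
    have "\<delta> \<bullet> x < \<delta>0 \<or> \<delta> \<bullet> y < \<delta>0"
    proof (rule ccontr)
      assume "\<not> (\<delta> \<bullet> x < \<delta>0 \<or> \<delta> \<bullet> y < \<delta>0)"
      then have "u * \<delta>0 + v * \<delta>0 \<le> \<delta> \<bullet> ?w"
        using uv by (auto simp: inner_add_right intro!: add_mono mult_left_mono)
      then show False
        using w uv by (simp flip: distrib_right)
    qed
    moreover have "?w = (1 - v) *\<^sub>R x + v *\<^sub>R y" "?w = (1 - u) *\<^sub>R y + u *\<^sub>R x"
      using uv'(3,4) by (simp_all add: add.commute)
    moreover have "x \<in> Q" "y \<in> Q"
      using xy by auto
    ultimately show False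
      using aux[OF xy(1) \<open>y \<in> Q\<close> uv(2) uv'(2)] aux[OF xy(2) \<open>x \<in> Q\<close> uv(1) uv'(1)] w by blast
  qed
  ultimately show "?w \<in> ?Y"
    by blast
qed

text \<open>After \<open>k\<close> rounds no violated point projects into a face of dimension less than \<open>k\<close>: the split
  body of a face of dimension \<open>k\<close> removes its relative interior, and its proper faces have been
  settled before.\<close>

lemma split_proof_of_violated_faces:
  fixes \<iota> :: "'p::finite \<Rightarrow> 'n::finite"
  assumes \<iota>: "inj \<iota>" and P: "convex P" and Q: "polyhedron (proj_level \<iota> P \<delta> \<delta>0)"
    and S: "\<S> \<noteq> {}"
    and L: "\<And>F. F \<in> violated_faces \<iota> P \<delta> \<delta>0 \<Longrightarrow> \<exists>L. cylinder \<iota> L \<in> \<S> \<and> rel_interior F \<subseteq> interior L"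
  shows "\<exists>k. valid_ineq \<delta> \<delta>0 (iterated_Cl k \<S> P)"
proof -
  let ?Q = "proj_level \<iota> P \<delta> \<delta>0"
  let ?P = "\<lambda>k. iterated_Cl k \<S> P"
  have sub: "?P k \<subseteq> P" for k
    using iterated_Cl_subset[OF P S] .
  have proj: "xpart \<iota> z \<in> ?Q" if "z \<in> ?P k" "\<delta> \<bullet> z \<le> \<delta>0" for z k
    using that sub by (auto simp: proj_level_def)
  have main: "\<delta>0 \<le> \<delta> \<bullet> z" if "F face_of ?Q" "aff_dim F < int k" "z \<in> ?P k" "xpart \<iota> z \<in> F" for F k z
    using that
  proof (induction k arbitrary: F z)
    \<comment> \<open>A face of negative dimension is empty, so nothing projects into it.\<close>
    case 0
    then show ?case
      using aff_dim_negative_iff[of F] by auto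
  next
    case (Suc k)
    show ?case
    proof (rule ccontr)
      assume "\<not> \<delta>0 \<le> \<delta> \<bullet> z"
      then have z: "\<delta> \<bullet> z < \<delta>0"
        by simp
      then have "F \<in> violated_faces \<iota> P \<delta> \<delta>0"
        using Suc.prems sub by (auto simp: violated_faces_def)
      then obtain L where L: "cylinder \<iota> L \<in> \<S>" "rel_interior F \<subseteq> interior L"
        using assms(5) by blast
      let ?Y = "{z \<in> ?P k. \<not> (\<delta> \<bullet> z < \<delta>0 \<and> xpart \<iota> z \<in> F)}"
      have Fpoly: "polyhedron F"
        using Q Suc.prems(1) by (rule face_of_polyhedron_polyhedron)
      have "{z \<in> ?P k. z \<notin> interior (cylinder \<iota> L)} \<subseteq> ?Y"
      proof (intro subsetI CollectI conjI notI; (elim CollectE conjE)?)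
        fix y assume y: "y \<in> ?P k" "y \<notin> interior (cylinder \<iota> L)" "\<delta> \<bullet> y < \<delta>0" "xpart \<iota> y \<in> F"
        then have "xpart \<iota> y \<notin> rel_interior F"
          using L(2) interior_cylinder[OF \<iota>, of L] by (auto simp: cylinder_def)
        then have "xpart \<iota> y \<in> rel_frontier F"
          using y(4) polyhedron_imp_closed[OF Fpoly] by (simp add: rel_frontier_def)
        then obtain G where G: "G face_of F" "G \<noteq> F" "xpart \<iota> y \<in> G"
          unfolding rel_frontier_of_polyhedron_alt[OF Fpoly] by blast
        have "aff_dim G < aff_dim F"
          using G(1,2) polyhedron_imp_convex[OF Fpoly] by (intro face_of_aff_dim_lt)
        moreover have "G face_of ?Q"
          using G(1) Suc.prems(1) by (rule face_of_trans)
        ultimately show False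
          using Suc.IH[of G y] Suc.prems(2) y(1,3) G(3) by simp
      qed
      then have "relax (cylinder \<iota> L) (?P k) \<subseteq> ?Y"
        unfolding relax_def using convex_below_level[OF convex_iterated_Cl[OF P] proj Suc.prems(1)]
        by (intro hull_minimal)
      moreover have "z \<in> relax (cylinder \<iota> L) (?P k)"
        using Suc.prems(3) L(1) by (auto simp: iterated_Cl_Suc Cl_def)
      ultimately show False
        using z Suc.prems(4) by blast
    qed
  qed
  have Qface: "?Q face_of ?Q"
    using polyhedron_imp_convex[OF Q] by (rule face_of_refl)
  \<comment> \<open>One round for each dimension from 0 to \<open>CARD('p)\<close> settles the
    improper face, into which every remaining violated point would project.\<close>
  have "aff_dim ?Q < int (Suc CARD('p))"
    using aff_dim_le_DIM[of ?Q] by simp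
  then have "valid_ineq \<delta> \<delta>0 (?P (Suc CARD('p)))"
    unfolding valid_ineq_def using main[OF Qface] proj by (meson linear)
  then show ?thesis
    by blast
qed

text \<open>\<open>D\<close> is spanned by mixed-integer points of value \<open>\<delta>0\<close> over the face, and \<open>u\<close> points downwards in
  the fibre. All rounds keep \<open>D\<close> together with a short step along \<open>u\<close> from every relatively interior
  point of \<open>D\<close>, because each body misses some point over the relative interior of the face.\<close>

lemma violation_persists:
  fixes \<iota> :: "'p::finite \<Rightarrow> 'n::finite"
  assumes \<iota>: "inj \<iota>" and P: "convex P"
    and F: "F = convex hull {x \<in> F. int_vec x}"
    and lift: "\<And>x. x \<in> F \<Longrightarrow> int_vec x \<Longrightarrow> \<exists>z\<in>P. xpart \<iota> z = x \<and> \<delta> \<bullet> z = \<delta>0"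
    and z0: "z0 \<in> P" "xpart \<iota> z0 \<in> F" "\<delta> \<bullet> z0 < \<delta>0"
    and S: "finite \<S>"
    and L: "\<And>L. L \<in> \<S> \<Longrightarrow> \<exists>Lx. split_polyhedron Lx \<and> L = cylinder \<iota> Lx \<and> \<not> rel_interior F \<subseteq> interior Lx"
  shows "\<exists>z\<in>iterated_Cl k \<S> P. \<delta> \<bullet> z < \<delta>0"
proof -
  have "\<forall>x\<in>{x \<in> F. int_vec x}. \<exists>z. z \<in> P \<and> xpart \<iota> z = x \<and> \<delta> \<bullet> z = \<delta>0"
    using lift by blast
  from bchoice[OF this] obtain f where
    f: "\<forall>x\<in>{x \<in> F. int_vec x}. f x \<in> P \<and> xpart \<iota> (f x) = x \<and> \<delta> \<bullet> f x = \<delta>0"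
    by blast
  define Z where "Z = f ` {x \<in> F. int_vec x}"
  define D where "D = convex hull Z"
  have convD: "convex D"
    by (simp add: D_def)
  have ZP: "Z \<subseteq> P"
    using f by (auto simp: Z_def)
  have Zint: "int_vec (xpart \<iota> z)" if "z \<in> Z" for z
    using that f by (auto simp: Z_def)
  have "xpart \<iota> ` Z = {x \<in> F. int_vec x}"
    using f by (force simp: Z_def image_iff)
  then have xD: "xpart \<iota> ` D = F"
    unfolding D_def convex_hull_linear_image[OF linear_xpart] using F by simp
  \<comment> \<open>Linear images commute with relative interiors, so a point of
    \<open>rel_interior F\<close> missed by a body has a lift in
    \<open>rel_interior D\<close>.\<close>
  have riD: "xpart \<iota> ` rel_interior D = rel_interior F"
    unfolding rel_interior_convex_linear_image[OF linear_xpart convD] xD ..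
  have "D \<subseteq> {z. \<delta> \<bullet> z = \<delta>0}"
    unfolding D_def using f by (intro hull_minimal convex_hyperplane) (auto simp: Z_def)
  then have levelD: "\<delta> \<bullet> d = \<delta>0" if "d \<in> D" for d
    using that by blast
  have "xpart \<iota> z0 \<in> xpart \<iota> ` D"
    using z0(2) by (simp only: xD)
  then obtain d0 where d0: "d0 \<in> D" "xpart \<iota> d0 = xpart \<iota> z0"
    by fastforce
  define u where "u = z0 - d0"
  have xu: "xpart \<iota> u = 0"
    using d0 by (simp add: u_def linear_diff[OF linear_xpart])
  have \<delta>u: "\<delta> \<bullet> u < 0"
    using z0(3) levelD[OF d0(1)] by (simp add: u_def inner_diff_right)
  \<comment> \<open>Depth is transported inside \<open>D\<close>: averaging the point
    \<open>e'\<close> steps along \<open>u\<close> from \<open>d'\<close> with a point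
    \<open>d1\<close> of \<open>D\<close> gives a point \<open>\<mu> * e'\<close> steps along
    \<open>u\<close> from \<open>d\<close>.\<close>
  have shift: "d + e *\<^sub>R u \<in> A"
    if A: "convex A" "D \<subseteq> A" "d' + e' *\<^sub>R u \<in> A" and d: "d' \<in> D" "d \<in> D" and \<mu>: "0 \<le> \<mu>" "\<mu> \<le> 1"
      and eq: "d = \<mu> *\<^sub>R d' + (1 - \<mu>) *\<^sub>R d1" "e = \<mu> * e'" and d1: "d1 \<in> D" for A d e d' e' \<mu> d1
  proof -
    have "d + e *\<^sub>R u = \<mu> *\<^sub>R (d' + e' *\<^sub>R u) + (1 - \<mu>) *\<^sub>R d1"
      by (simp add: eq algebra_simps)
    then show ?thesis
      using A \<mu> d1 by (auto intro!: convexD)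
  qed
  \<comment> \<open>The depth may shrink with every round and depends on \<open>d\<close>; only its
    positivity is maintained.\<close>
  have inv: "Z \<subseteq> iterated_Cl k \<S> P \<and> (\<forall>d\<in>rel_interior D. \<exists>e>0. d + e *\<^sub>R u \<in> iterated_Cl k \<S> P)" for k
  proof (induction k)
    case 0
    have DP: "D \<subseteq> P"
      unfolding D_def using ZP P by (intro hull_minimal)
    have "\<exists>e>0. d + e *\<^sub>R u \<in> P" if d: "d \<in> rel_interior D" for d
    proof -
      obtain d1 \<mu> where \<mu>: "d1 \<in> D" "0 < \<mu>" "\<mu> < 1" "d = \<mu> *\<^sub>R d0 + (1 - \<mu>) *\<^sub>R d1"
        using rel_interior_combination[OF convD d d0(1)] by metis
      have "d0 + 1 *\<^sub>R u \<in> P"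
        using z0(1) by (simp add: u_def)
      then have "d + \<mu> *\<^sub>R u \<in> P"
        using shift[OF P DP _ d0(1) _ _ _ \<mu>(4) _ \<mu>(1), of 1 \<mu>] \<mu>(2,3) d rel_interior_subset by auto
      then show ?thesis
        using \<mu>(2) by blast
    qed
    then show ?case
      using ZP by (simp add: iterated_Cl_0)
  next
    case (Suc k)
    let ?Q = "iterated_Cl k \<S> P"
    have ZL: "Z \<subseteq> relax L ?Q" if LS: "L \<in> \<S>" for L
    proof
      fix z assume z: "z \<in> Z"
      obtain Lx where Lx: "split_polyhedron Lx" "L = cylinder \<iota> Lx"
        using L[OF LS] by blast
      have "xpart \<iota> z \<notin> interior Lx"
        using Lx(1) Zint[OF z] interior_subset_rel_interior[of Lx]
        by (auto simp: split_polyhedron_def lattice_point_free_def)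
      then have "z \<notin> interior L"
        unfolding Lx(2) interior_cylinder[OF \<iota>] by (simp add: cylinder_def)
      then show "z \<in> relax L ?Q"
        unfolding relax_def using z Suc.IH by (intro hull_inc) auto
    qed
    have DL: "D \<subseteq> relax L ?Q" if "L \<in> \<S>" for L
      unfolding D_def using ZL[OF that] by (intro hull_minimal) (auto simp: relax_def)
    have step: "\<exists>e>0. d + e *\<^sub>R u \<in> relax L ?Q" if "L \<in> \<S>" and d: "d \<in> rel_interior D" for L d
    proof -
      obtain Lx where Lx: "L = cylinder \<iota> Lx" "\<not> rel_interior F \<subseteq> interior Lx"
        using L[OF \<open>L \<in> \<S>\<close>] by blast
      then obtain x where x: "x \<in> rel_interior F" "x \<notin> interior Lx"
        by blast
      have "x \<in> xpart \<iota> ` rel_interior D"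
        using x(1) by (simp only: riD)
      then obtain d' where d': "d' \<in> rel_interior D" "xpart \<iota> d' = x"
        by fastforce
      then have d'D: "d' \<in> D"
        using rel_interior_subset by blast
      obtain e' where e': "e' > 0" "d' + e' *\<^sub>R u \<in> ?Q"
        using Suc.IH d'(1) by blast
      have "xpart \<iota> (d' + e' *\<^sub>R u) = x"
        using d'(2) xu by (simp add: linear_add[OF linear_xpart] linear_cmul[OF linear_xpart])
      then have "d' + e' *\<^sub>R u \<notin> interior L"
        unfolding Lx(1) interior_cylinder[OF \<iota>] using x(2) by (simp add: cylinder_def)
      then have mem: "d' + e' *\<^sub>R u \<in> relax L ?Q"
        unfolding relax_def using e'(2) by (intro hull_inc) auto
      obtain d1 \<mu> where \<mu>: "d1 \<in> D" "0 < \<mu>" "\<mu> < 1" "d = \<mu> *\<^sub>R d' + (1 - \<mu>) *\<^sub>R d1"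
        using rel_interior_combination[OF convD d d'D] by metis
      have "convex (relax L ?Q)"
        by (simp add: relax_def)
      then have "d + (\<mu> * e') *\<^sub>R u \<in> relax L ?Q"
        using shift[OF _ DL[OF \<open>L \<in> \<S>\<close>] mem d'D _ _ _ \<mu>(4) refl \<mu>(1)] \<mu>(2,3) d rel_interior_subset by auto
      then show ?thesis
        using \<mu>(2) e'(1) by (intro exI[of _ "\<mu> * e'"]) simp
    qed
    have "\<exists>e>0. d + e *\<^sub>R u \<in> iterated_Cl (Suc k) \<S> P" if d: "d \<in> rel_interior D" for d
    proof -
      have "\<forall>L\<in>\<S>. \<exists>e. e > 0 \<and> d + e *\<^sub>R u \<in> relax L ?Q"
        using step d by blast
      from bchoice[OF this] obtain e where e: "\<forall>L\<in>\<S>. e L > 0 \<and> d + e L *\<^sub>R u \<in> relax L ?Q"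
        by blast
      \<comment> \<open>The 1 keeps the minimum defined when the family is empty.\<close>
      define m where "m = Min (insert 1 (e ` \<S>))"
      have m0: "0 < m"
        unfolding m_def using S e by (subst Min_gr_iff) auto
      have dD: "d \<in> D"
        using d rel_interior_subset by blast
      have "d + m *\<^sub>R u \<in> relax L ?Q" if "L \<in> \<S>" for L
      proof -
        have "m \<le> e L"
          unfolding m_def using S that by (intro Min_le) auto
        moreover have "0 < e L" "d + e L *\<^sub>R u \<in> relax L ?Q"
          using e that by auto
        moreover have "convex (relax L ?Q)"
          by (simp add: relax_def)
        \<comment> \<open>Reducing the depth over a single point is the case of \<open>shift\<close>
          in which all three base points are \<open>d\<close>.\<close>
        moreover have "d = (m / e L) *\<^sub>R d + (1 - m / e L) *\<^sub>R d"
          by (simp flip: scaleR_add_left)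
        ultimately show ?thesis
          using shift[of "relax L ?Q" d "e L" d "m / e L" d m] DL[OF that] dD m0 by auto
      qed
      then show ?thesis
        using m0 by (auto simp: iterated_Cl_Suc Cl_def)
    qed
    moreover have "Z \<subseteq> iterated_Cl (Suc k) \<S> P"
      using ZL by (auto simp: iterated_Cl_Suc Cl_def)
    ultimately show ?case
      by blast
  qed
  have "D \<noteq> {}"
    using d0(1) by blast
  then obtain d where d: "d \<in> rel_interior D"
    using rel_interior_eq_empty[OF convD] by blast
  then obtain e where e: "e > 0" "d + e *\<^sub>R u \<in> iterated_Cl k \<S> P"
    using inv[of k] by blast
  have "\<delta> \<bullet> (d + e *\<^sub>R u) = \<delta>0 + e * (\<delta> \<bullet> u)"
    using levelD d rel_interior_subset by (auto simp: inner_add_right)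
  also have "\<dots> < \<delta>0"
    using e(1) \<delta>u by (simp add: mult_pos_neg)
  finally show ?thesis
    using e(2) by blast
qed

text \<open>A relatively interior lattice point would be a proper convex combination of the
  projection of a violating point and another point of the face. The same combination of lifts would
  be a mixed-integer point of value below \<open>\<delta>0\<close>.\<close>

lemma violated_face_lattice_free:
  assumes P: "convex P" and valid: "valid_ineq \<delta> \<delta>0 (mixed_int_points \<iota> P)"
    and F: "F \<in> violated_faces \<iota> P \<delta> \<delta>0" and v: "v \<in> rel_interior F"
  shows "\<not> int_vec v"
proof
  assume iv: "int_vec v"
  obtain z where z: "F face_of proj_level \<iota> P \<delta> \<delta>0" "z \<in> P" "xpart \<iota> z \<in> F" "\<delta> \<bullet> z < \<delta>0"
    using F by (auto simp: violated_faces_def)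
  obtain y \<mu> where y: "y \<in> F" "0 < \<mu>" "\<mu> < 1" "v = \<mu> *\<^sub>R xpart \<iota> z + (1 - \<mu>) *\<^sub>R y"
    using rel_interior_combination[OF face_of_imp_convex[OF z(1)] v z(3)] by metis
  obtain w where w: "w \<in> P" "\<delta> \<bullet> w \<le> \<delta>0" "y = xpart \<iota> w"
    using y(1) face_of_imp_subset[OF z(1)] by (auto simp: proj_level_def)
  let ?m = "\<mu> *\<^sub>R z + (1 - \<mu>) *\<^sub>R w"
  have "?m \<in> P"
    using P z w y by (intro convexD) auto
  moreover have "xpart \<iota> ?m = v"
    using y(4) w(3) by (simp add: linear_add[OF linear_xpart] linear_cmul[OF linear_xpart])
  ultimately have "\<delta>0 \<le> \<delta> \<bullet> ?m"
    using valid iv by (simp add: valid_ineq_def mixed_int_points_def)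
  moreover have "\<mu> * (\<delta> \<bullet> z) < \<mu> * \<delta>0" "(1 - \<mu>) * (\<delta> \<bullet> w) \<le> (1 - \<mu>) * \<delta>0"
    using z w y by (auto intro: mult_left_mono)
  ultimately show False
    by (simp add: inner_add_right algebra_simps)
qed

lemma convex_rational_polyhedron: "rational_polyhedron S \<Longrightarrow> convex S"
  using rational_polyhedron_imp_sol_set convex_sol_set by metis

lemma Least_has_minimum:
  fixes A :: "real set"
  assumes "has_minimum A"
  shows "(LEAST w. w \<in> A) \<in> A" "\<And>a. a \<in> A \<Longrightarrow> (LEAST w. w \<in> A) \<le> a"
proof -
  obtain m where m: "m \<in> A" "\<forall>a\<in>A. m \<le> a"
    using assms by (auto simp: has_minimum_def)
  then have "(LEAST w. w \<in> A) = m"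
    by (intro Least_equality) auto
  with m show "(LEAST w. w \<in> A) \<in> A" "\<And>a. a \<in> A \<Longrightarrow> (LEAST w. w \<in> A) \<le> a"
    by auto
qed

theorem theorem5p1:
  fixes \<iota> :: "'p::finite \<Rightarrow> 'n::finite"
    and P :: "(real ^ 'n) set"
    and \<delta> :: "real ^ 'n"
    and \<delta>0 :: real
  assumes "inj \<iota>"
    and "rational_polyhedron P"
    and "generated_by_vertices_and_rays P"
    and "rat_vec \<delta>"
    and "\<delta>0 \<in> \<rat>"
    and "valid_ineq \<delta> \<delta>0 (mixed_int_points \<iota> P)"
    and "\<exists>z\<in>mixed_int_points \<iota> P. \<delta> \<bullet> z = \<delta>0"
    and "\<exists>z\<in>P. (\<forall>z'\<in>P. \<delta> \<bullet> z \<le> \<delta> \<bullet> z') \<and> \<delta> \<bullet> z < \<delta>0"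
    and "proj_level \<iota> P \<delta> \<delta>0 = convex hull {x \<in> proj_level \<iota> P \<delta> \<delta>0. int_vec x}"
  shows "(\<forall>F\<in>violated_faces \<iota> P \<delta> \<delta>0. has_minimum (face_widths \<iota> F)) \<and>
         has_minimum (proof_widths \<iota> P \<delta> \<delta>0) \<and>
         width_size \<iota> P \<delta> \<delta>0 = Max (face_width_size \<iota> ` violated_faces \<iota> P \<delta> \<delta>0)"
proof -
  let ?Q = "proj_level \<iota> P \<delta> \<delta>0"
  let ?V = "violated_faces \<iota> P \<delta> \<delta>0"
  have P: "convex P"
    using assms(2) by (rule convex_rational_polyhedron)
  obtain C where C: "finite C" "?Q = sol_set C"
    using rational_polyhedron_imp_sol_set[OF rational_polyhedron_proj_level[OF assms(1,2,4,5)]] .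
  have polyQ: "polyhedron ?Q"
    using C polyhedron_sol_set by metis
  have V: "F face_of ?Q" "F \<noteq> {}" "convex F" if "F \<in> ?V" for F
    using that face_of_imp_convex by (auto simp: violated_faces_def)
  have Vconv: "F = convex hull {x \<in> F. int_vec x}" if "F \<in> ?V" for F
  proof -
    have "{x \<in> ?Q. int_vec x} \<inter> F = {x \<in> F. int_vec x}"
      using face_of_imp_subset[OF V(1)[OF that]] by blast
    then show ?thesis
      using face_of_integral_hull[OF V(1)[OF that] assms(9)] by simp
  qed
  have finV: "finite ?V"
    using finite_subset[OF _ finite_polyhedron_faces[OF polyQ]] by (auto simp: violated_faces_def)
  obtain z where z: "z \<in> P" "\<delta> \<bullet> z < \<delta>0"
    using assms(8) by blast
  \<comment> \<open>The improper face is violated, so the maximum is taken over a nonempty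
    set.\<close>
  have "?Q \<in> ?V"
    using z face_of_refl[OF polyhedron_imp_convex[OF polyQ]]
    by (auto simp: violated_faces_def proj_level_def intro: less_imp_le)
  then have neV: "?V \<noteq> {}"
    by blast
  have min: "has_minimum (face_widths \<iota> F)" if F: "F \<in> ?V" for F
  proof -
    obtain L where "split_polyhedron L" "rel_interior F \<subseteq> interior L"
      using face_in_split_polyhedron[OF C(1) V(1)[OF F, unfolded C(2)] V(2)[OF F]
        violated_face_lattice_free[OF P assms(6) F]] by blast
    then have "face_widths \<iota> F \<noteq> {}"
      by (auto simp: face_widths_def)
    then show ?thesis
      using has_minimum_face_widths[OF assms(1) V(3,2)[OF F] Vconv[OF F]] by blast
  qed
  have "\<forall>F\<in>?V. \<exists>L. split_polyhedron L \<and> rel_interior F \<subseteq> interior L \<and>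
      face_width_size \<iota> F = max_facet_width \<iota> (cylinder \<iota> L)"
    using Least_has_minimum(1)[OF min] unfolding face_width_size_def face_widths_def by blast
  from bchoice[OF this] obtain L where L: "\<forall>F\<in>?V. split_polyhedron (L F) \<and>
      rel_interior F \<subseteq> interior (L F) \<and> face_width_size \<iota> F = max_facet_width \<iota> (cylinder \<iota> (L F))"
    by blast
  define \<S> where "\<S> = (\<lambda>F. cylinder \<iota> (L F)) ` ?V"
  define w where "w = Max (face_width_size \<iota> ` ?V)"
  have "\<exists>k. valid_ineq \<delta> \<delta>0 (iterated_Cl k \<S> P)"
    using L neV by (intro split_proof_of_violated_faces[OF assms(1) P polyQ]) (auto simp: \<S>_def)
  moreover have "finite \<S>" "\<forall>L\<in>\<S>. mi_split_polyhedron \<iota> L"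
    using finV L by (auto simp: \<S>_def mi_split_polyhedron_def)
  ultimately have "split_proof \<iota> P \<delta> \<delta>0 \<S>"
    by (simp add: split_proof_def)
  moreover have "proof_width \<iota> \<S> = w"
  proof -
    have "max_facet_width \<iota> ` \<S> = face_width_size \<iota> ` ?V"
      unfolding \<S>_def image_image using L by (intro image_cong) auto
    then show ?thesis
      by (simp add: proof_width_def w_def)
  qed
  ultimately have mem: "w \<in> proof_widths \<iota> P \<delta> \<delta>0"
    unfolding proof_widths_def by blast
  have lower: "w \<le> a" if a: "a \<in> proof_widths \<iota> P \<delta> \<delta>0" for a
  proof -
    obtain \<T> k where T: "a = proof_width \<iota> \<T>" "finite \<T>" "\<forall>L\<in>\<T>. mi_split_polyhedron \<iota> L"
      "valid_ineq \<delta> \<delta>0 (iterated_Cl k \<T> P)"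
      using a by (auto simp: proof_widths_def split_proof_def)
    have "face_width_size \<iota> F \<le> a" if F: "F \<in> ?V" for F
    proof -
      obtain z0 where z0: "z0 \<in> P" "xpart \<iota> z0 \<in> F" "\<delta> \<bullet> z0 < \<delta>0"
        using F by (auto simp: violated_faces_def)
      \<comment> \<open>The lift has value at most \<open>\<delta>0\<close> by definition of the
        level set, and validity at mixed-integer points gives the reverse bound.\<close>
      have lift: "\<exists>z\<in>P. xpart \<iota> z = x \<and> \<delta> \<bullet> z = \<delta>0" if x: "x \<in> F" "int_vec x" for x
      proof -
        obtain z where z: "z \<in> P" "\<delta> \<bullet> z \<le> \<delta>0" "x = xpart \<iota> z"
          using face_of_imp_subset[OF V(1)[OF F]] x(1) by (auto simp: proj_level_def)
        then have "\<delta>0 \<le> \<delta> \<bullet> z"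
          using assms(6) x(2) by (simp add: valid_ineq_def mixed_int_points_def)
        with z show ?thesis
          by (intro bexI[of _ z]) auto
      qed
      have "\<exists>L\<in>\<T>. \<exists>Lx. split_polyhedron Lx \<and> L = cylinder \<iota> Lx \<and> rel_interior F \<subseteq> interior Lx"
      proof (rule ccontr)
        assume no: "\<not> ?thesis"
        have bodies: "\<exists>Lx. split_polyhedron Lx \<and> L = cylinder \<iota> Lx \<and> \<not> rel_interior F \<subseteq> interior Lx"
          if LT: "L \<in> \<T>" for L
        proof -
          obtain Lx where Lx: "split_polyhedron Lx" "L = cylinder \<iota> Lx"
            using T(3) LT unfolding mi_split_polyhedron_def by blast
          moreover have "\<not> rel_interior F \<subseteq> interior Lx"
            using no LT Lx by blast
          ultimately show ?thesis
            by blast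
        qed
        obtain z where "z \<in> iterated_Cl k \<T> P" "\<delta> \<bullet> z < \<delta>0"
          using violation_persists[OF assms(1) P Vconv[OF F] lift z0 T(2) bodies, of k] by blast
        with T(4) show False
          by (force simp: valid_ineq_def)
      qed
      then obtain M Lx where M: "M \<in> \<T>" "split_polyhedron Lx" "M = cylinder \<iota> Lx"
        "rel_interior F \<subseteq> interior Lx"
        by blast
      then have "max_facet_width \<iota> M \<in> face_widths \<iota> F"
        unfolding face_widths_def by blast
      then have "face_width_size \<iota> F \<le> max_facet_width \<iota> M"
        unfolding face_width_size_def using Least_has_minimum(2)[OF min[OF F]] by blast
      also have "\<dots> \<le> a"
        unfolding T(1) proof_width_def using T(2) M(1) by (intro Max_ge) auto
      finally show ?thesis .
    qed
    then show ?thesis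
      unfolding w_def using finV neV by (intro Max.boundedI) auto
  qed
  have "has_minimum (proof_widths \<iota> P \<delta> \<delta>0)"
    unfolding has_minimum_def using mem lower by blast
  moreover have "width_size \<iota> P \<delta> \<delta>0 = w"
    unfolding width_size_def using mem lower by (rule Least_equality)
  ultimately show ?thesis
    using min unfolding w_def by blast
qed

end
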